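(* Let $n\ge1$ and let $\alpha=(\alpha_1,\dots,\alpha_n)$ with $\alpha_i>0$ for all $i$. There is a constant $C_\alpha$ such that for all $f\in\mathcal S(\mathbf R^n)$ and all $x\in\mathbf R^n$, $$g_0(f)(x)\le C_\alpha\,\mu_\alpha(f)(x).$$
   Context: $\mathcal S(\mathbf R^n)$ is the Schwartz space. Let $u(x,t)=P_t\star f(x)$ be the iterated Poisson integral of $f$, where $P_t(x)=\prod_{i=1}^n\frac{t_i}{\pi(x_i^2+t_i^2)}$ for $t=(t_1,\dots,t_n)$, $t_i>0$, and $$g_0(f)(x)=\left(\int_0^\infty\cdots\int_0^\infty\left|\frac{\partial}{\partial x_1}\cdots\frac{\partial}{\partial x_n}u(x,t)\right|^2t_1\cdots t_n\,dt_1\cdots dt_n\right)^{1/2}.$$ For $a>0$ let $\varphi^{(a)}(x)=a\,|1-|x||^{a-1}(\chi_{[0,1]}(x)-\chi_{[-1,0]}(x))$ on $\mathbf R$ and $\varphi^{(a)}_s(x)=s^{-1}\varphi^{(a)}(x/s)$ for $s>0$. For $t=(t_1,\dots,t_n)$, $t_i>0$, put $\Phi_t^{(\alpha)}(x)=\prod_{i=1}^n\varphi^{(\alpha_i)}_{t_i}(x_i)$, $S_t^\alpha(f)=f\star\Phi_t^{(\alpha)}$ and $$\mu_\alpha(f)(x)=\left(\int_0^\infty\cdots\int_0^\infty|S_t^\alpha(f)(x)|^2\,\frac{dt_1}{t_1}\cdots\frac{dt_n}{t_n}\right)^{1/2}.$$ *)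

theory Defs
  imports "HOL-Analysis.Analysis"
begin

text \<open>
  Euclidean $n$-space is \<^typ>\<open>real ^ 'n\<close>; functions on it are complex-valued. The linear order
  on \<open>'n\<close> numbers the coordinates and only fixes the order in which
  $\partial_{x_1}, \dots, \partial_{x_n}$ are applied.
\<close>

definition partial :: "'n::finite \<Rightarrow> (real ^ 'n \<Rightarrow> complex) \<Rightarrow> real ^ 'n \<Rightarrow> complex" where
  "partial i f x = vector_derivative (\<lambda>h. f (x + h *\<^sub>R axis i 1)) (at 0)"

text \<open>For \<open>js = [j1, ..., jk]\<close> this is $\partial_{j_1} \cdots \partial_{j_k} f$, so \<open>jk\<close> is applied first.\<close>

definition partials :: "'n::finite list \<Rightarrow> (real ^ 'n \<Rightarrow> complex) \<Rightarrow> real ^ 'n \<Rightarrow> complex" where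
  "partials js f = foldr partial js f"

text \<open>Differentiability of the iterated partial derivatives of every order says that \<open>f\<close> is smooth.\<close>

definition schwartz :: "(real ^ 'n::finite \<Rightarrow> complex) set" where
  "schwartz = {f. \<forall>js. (\<forall>x. partials js f differentiable (at x)) \<and>
                      (\<forall>k::nat. bounded (range (\<lambda>x. norm x ^ k *\<^sub>R partials js f x)))}"

definition convol ::
    "(real ^ 'n::finite \<Rightarrow> complex) \<Rightarrow> (real ^ 'n \<Rightarrow> complex) \<Rightarrow> real ^ 'n \<Rightarrow> complex" where
  "convol f g x = (\<integral>y. f (x - y) * g y \<partial>lborel)"

text \<open>
  The square functions take values in $[0,\infty]$, so they are defined without assuming that the
  integrals are finite.
\<close>

definition ennreal_sqrt :: "ennreal \<Rightarrow> ennreal" where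
  "ennreal_sqrt z = (if z = \<infinity> then \<infinity> else ennreal (sqrt (enn2real z)))"

definition pos_orthant :: "(real ^ 'n::finite) set" where
  "pos_orthant = {t. \<forall>i. 0 < t $ i}"

definition poisson_kernel :: "real ^ 'n::finite \<Rightarrow> real ^ 'n \<Rightarrow> real" where
  "poisson_kernel t x = (\<Prod>i\<in>UNIV. t $ i / (pi * ((x $ i)\<^sup>2 + (t $ i)\<^sup>2)))"

definition poisson_integral ::
    "(real ^ 'n::finite \<Rightarrow> complex) \<Rightarrow> real ^ 'n \<Rightarrow> real ^ 'n \<Rightarrow> complex" where
  "poisson_integral f x t = convol (\<lambda>y. complex_of_real (poisson_kernel t y)) f x"

definition g0 ::
    "(real ^ 'n::{finite,linorder} \<Rightarrow> complex) \<Rightarrow> real ^ 'n::{finite,linorder} \<Rightarrow> ennreal" where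
  "g0 f x = ennreal_sqrt
     (\<integral>\<^sup>+t\<in>pos_orthant.
        ennreal ((cmod (partials (sorted_list_of_set UNIV) (\<lambda>x. poisson_integral f x t) x))\<^sup>2
                 * (\<Prod>i\<in>UNIV. t $ i)) \<partial>lborel)"

text \<open>
  Since \<open>0 powr b = 0\<close>, the value at \<open>\<bar>x\<bar> = 1\<close> is \<open>0\<close>; this affects only a null set.
\<close>

definition phi :: "real \<Rightarrow> real \<Rightarrow> real" where
  "phi a x = a * \<bar>1 - \<bar>x\<bar>\<bar> powr (a - 1) * (indicator {0..1} x - indicator {-1..0} x)"

definition phi_dil :: "real \<Rightarrow> real \<Rightarrow> real \<Rightarrow> real" where
  "phi_dil a s x = phi a (x / s) / s"

definition Phi :: "real ^ 'n::finite \<Rightarrow> real ^ 'n \<Rightarrow> real ^ 'n \<Rightarrow> real" where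
  "Phi \<alpha> t x = (\<Prod>i\<in>UNIV. phi_dil (\<alpha> $ i) (t $ i) (x $ i))"

definition S_op ::
    "real ^ 'n::finite \<Rightarrow> real ^ 'n \<Rightarrow> (real ^ 'n \<Rightarrow> complex) \<Rightarrow> real ^ 'n \<Rightarrow> complex" where
  "S_op \<alpha> t f = convol f (\<lambda>y. complex_of_real (Phi \<alpha> t y))"

definition marcinkiewicz ::
    "real ^ 'n::finite \<Rightarrow> (real ^ 'n \<Rightarrow> complex) \<Rightarrow> real ^ 'n \<Rightarrow> ennreal" where
  "marcinkiewicz \<alpha> f x = ennreal_sqrt
     (\<integral>\<^sup>+t\<in>pos_orthant. ennreal ((cmod (S_op \<alpha> t f x))\<^sup>2 / (\<Prod>i\<in>UNIV. t $ i)) \<partial>lborel)"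

end

theory Submission
  imports Defs "HOL-Real_Asymp.Real_Asymp"
begin

text \<open>
  In one variable $t\,\partial_y P_t(y)$ is a superposition $\int_0^\infty \varphi^{(a)}_s(y) V(t,s)\,ds$:
  for $y > 0$ this is an Abel integral equation with right-hand side $\frac{t}{\pi}\,\mathrm{Im}\,(y+it)^{-2}$,
  solved by $V(t,s) = \frac{a+1}{\pi}\,t\,s^a\,\mathrm{Im}\,(s+it)^{-a-2}$, and $|V(t,s)| \le (a+1) P_t(s)$.
  Taking products and integrating against $f$,
  $t_1\cdots t_n\,|\partial_1\cdots\partial_n u(x,t)| \le C \int P_t(s)\,|S_s^\alpha f(x)|\,ds$ with
  $C = \prod_i(\alpha_i+1)$. Since $\int P_t(s)\,ds \le 1$ and $P_t(s)/\prod_i t_i$ is symmetric in $s$ and $t$,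
  the Cauchy--Schwarz inequality and Tonelli's theorem bound the $L^2(\prod_i dt_i/t_i)$ norm.
\<close>

subsection \<open>Cauchy densities and powers of a quotient\<close>

text \<open>Why V has this form: for y > 0 the dilate phi_s(y) is a s^{-a} (s-y)^{a-1} when s > y
  and 0 when s < y. The factor s^a of V removes s^{-a}, leaving a kernel in s - y alone, that is, a
  Weyl fractional integral of order a. Such integrals map powers of s+it to powers of y+it: the
  exponent -a-2 is the one that produces -2, and the Beta value B(a,2) = 1/(a(a+1)) dictates the
  factor a+1. Powers of the complex variable s+it keep everything in closed form for non-integer a.
  The obstacle is convergence. For a < 1 the integrand is singular at s = y, and it is complex, so
  absolute integrability cannot be read off from an antiderivative. It comes from a real majorant of
  the same type, with a bound independent of y; this uniformity justifies exchanging the integral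
  over s with the integration against f. The bound on |V| discards all signs. Afterwards only
  positive kernels of mass at most 1 occur, so no further constants enter C.\<close>

definition cauchy_density :: "real \<Rightarrow> real \<Rightarrow> real" where
  "cauchy_density t y = t / (pi * (y\<^sup>2 + t\<^sup>2))"

definition cauchy_density_deriv :: "real \<Rightarrow> real \<Rightarrow> real" where
  "cauchy_density_deriv t y = - (2 * t * y) / (pi * (y\<^sup>2 + t\<^sup>2)\<^sup>2)"

text \<open>
  The function multiplied by \<open>s powr a\<close> is the fractional derivative of order \<open>a\<close> of
  \<open>t * cauchy_density_deriv t\<close>, up to a constant: the imaginary part of $(y+it)^{-2}$, with
  the exponent lowered by \<open>a\<close>.
\<close>

definition weight :: "real \<Rightarrow> real \<Rightarrow> real \<Rightarrow> real" where
  "weight a t s = (a + 1) / pi * t * s powr a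
     * Im ((complex_of_real s + \<i> * complex_of_real t) powr of_real (- (a + 2)))"

lemma sum_squares_pos: "t > 0 \<Longrightarrow> 0 < (y::real)\<^sup>2 + t\<^sup>2"
  by (simp add: add_nonneg_pos)

lemma cauchy_density_nonneg: "t > 0 \<Longrightarrow> 0 \<le> cauchy_density t y"
  by (simp add: cauchy_density_def)

lemma cauchy_density_sym: "s > 0 \<Longrightarrow> t > 0 \<Longrightarrow> cauchy_density t s / t = cauchy_density s t / s"
  by (simp add: cauchy_density_def add.commute)

lemma has_real_derivative_cauchy_density:
  assumes "t > 0"
  shows "(cauchy_density t has_real_derivative cauchy_density_deriv t y) (at y)"
  unfolding cauchy_density_def[abs_def] cauchy_density_deriv_def
  using sum_squares_pos[OF assms, of y]
  by (auto intro!: derivative_eq_intros simp: power2_eq_square mult_ac)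

lemma nn_integral_cauchy_density:
  assumes "t > 0"
  shows "(\<integral>\<^sup>+y. ennreal (cauchy_density t y) \<partial>lborel) = 1"
proof -
  let ?F = "\<lambda>y. arctan (y / t) / pi"
  have deriv: "(?F has_real_derivative cauchy_density t y) (at y)" for y
  proof -
    have "1 + (y / t)\<^sup>2 = (y\<^sup>2 + t\<^sup>2) / t\<^sup>2"
      using assms by (simp add: field_simps)
    then have "inverse (1 + (y / t)\<^sup>2) * (1 / t) / pi = cauchy_density t y"
      using assms by (simp add: cauchy_density_def power2_eq_square)
    then show ?thesis
      using assms by (auto intro!: derivative_eq_intros simp: divide_simps)
  qed
  have cont: "isCont (cauchy_density t) y" for y
    using has_real_derivative_cauchy_density[OF assms] DERIV_isCont by blast
  have bot: "((?F \<circ> real_of_ereal) \<longlongrightarrow> - (1 / 2)) (at_right (-\<infinity>))"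
  proof -
    have "filterlim (\<lambda>y. y / t) at_bot at_bot"
      using assms by real_asymp
    then have "((\<lambda>y. arctan (y / t)) \<longlongrightarrow> - (pi / 2)) at_bot"
      by (rule filterlim_compose[OF tendsto_arctan_at_bot])
    from tendsto_divide[OF this tendsto_const[of pi]] show ?thesis
      by (simp add: ereal_tendsto_simps)
  qed
  have top: "((?F \<circ> real_of_ereal) \<longlongrightarrow> 1 / 2) (at_left \<infinity>)"
  proof -
    have "filterlim (\<lambda>y. y / t) at_top at_top"
      using assms by real_asymp
    then have "((\<lambda>y. arctan (y / t)) \<longlongrightarrow> pi / 2) at_top"
      by (rule filterlim_compose[OF tendsto_arctan_at_top])
    from tendsto_divide[OF this tendsto_const[of pi]] show ?thesis
      by (simp add: ereal_tendsto_simps)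
  qed
  have "set_integrable lborel (einterval (-\<infinity>) \<infinity>) (cauchy_density t)"
    "(LBINT y=-\<infinity>..\<infinity>. cauchy_density t y) = 1 / 2 - (- (1 / 2))"
    using deriv cont cauchy_density_nonneg[OF assms]
    by (intro interval_integral_FTC_nonneg[OF _ _ _ _ bot top]; simp)+
  then have "integrable lborel (cauchy_density t)" "(\<integral>y. cauchy_density t y \<partial>lborel) = 1"
    by (simp_all add: set_integrable_def interval_lebesgue_integral_def set_lebesgue_integral_def)
  then show ?thesis
    using cauchy_density_nonneg[OF assms] by (simp add: nn_integral_eq_integral)
qed

section \<open>Antiderivatives and Beta-type integrals of powers of a quotient\<close>

text \<open>With v = (s-y)/(s+z) the function is v^b / b, and dv/ds = (y+z)/(s+z)^2. The two powers
  are kept apart so that only one complex power, off the branch cut, is differentiated. A general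
  complex z covers both z = t (real majorant) and z = it.\<close>

lemma has_vector_derivative_powr_quotient:
  fixes z :: complex
  assumes "b > 0" "y < s" "of_real s + z \<notin> \<real>\<^sub>\<le>\<^sub>0"
  shows "((\<lambda>s. of_real ((s - y) powr b) * (of_real s + z) powr of_real (- b) / of_real b)
    has_vector_derivative
      of_real ((s - y) powr (b - 1)) * (of_real s + z) powr of_real (- b - 1) * (of_real y + z)) (at s)"
proof -
  have "((\<lambda>s. (s - y) powr b) has_vector_derivative b * (s - y) powr (b - 1)) (at s)"
    using assms by (auto intro!: derivative_eq_intros
        simp flip: has_real_derivative_iff_has_vector_derivative)
  from bounded_linear.has_vector_derivative[OF bounded_linear_of_real this]
  have 1: "((\<lambda>s. complex_of_real ((s - y) powr b))
    has_vector_derivative of_real (b * (s - y) powr (b - 1))) (at s)" .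
  have "((\<lambda>w. w powr of_real (- b)) has_field_derivative
      of_real (- b) * (of_real s + z) powr (of_real (- b) - 1)) (at (of_real s + z))"
    by (rule has_field_derivative_powr[OF assms(3)])
  moreover have "((\<lambda>s. complex_of_real s + z) has_vector_derivative 1) (at s)"
    by (auto intro!: derivative_eq_intros)
  ultimately have 2: "((\<lambda>s. (complex_of_real s + z) powr of_real (- b)) has_vector_derivative
      of_real (- b) * (of_real s + z) powr (of_real (- b) - 1)) (at s)"
    using field_vector_diff_chain_at[where f = "\<lambda>s. complex_of_real s + z"] by (fastforce simp: o_def)
  have nz: "of_real s + z \<noteq> 0"
    using assms(3) by auto
  \<comment> \<open>Lowering both exponents by one exposes the common factor; the bracket that
    remains is (s+z) - (s-y) = y+z.\<close>
  have e1: "(s - y) powr b = (s - y) powr (b - 1) * (s - y)"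
    using assms(2) by (simp add: powr_diff)
  have e2: "(of_real s + z) powr of_real (- b) = (of_real s + z) powr (of_real (- b) - 1) * (of_real s + z)"
    using nz by (simp add: powr_diff)
  show ?thesis
    by (rule has_vector_derivative_eq_rhs[OF has_vector_derivative_divide[OF has_vector_derivative_mult[OF 1 2]]],
        unfold e1 e2) (use \<open>b > 0\<close> in \<open>simp add: field_simps\<close>)
qed

text \<open>Factoring the positive real s-y out of s+z leaves a principal power of a base that tends
  to 1, where the power is continuous.\<close>

lemma tendsto_powr_quotient_at_top:
  fixes z :: complex
  shows "((\<lambda>s. of_real ((s - y) powr b) * (of_real s + z) powr of_real (- b)) \<longlongrightarrow> 1) at_top"
proof -
  have "((\<lambda>s. (1 + (of_real y + z) / of_real (s - y)) powr of_real (- b)) \<longlongrightarrow> (1 + 0) powr of_real (- b)) at_top"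
  proof (intro tendsto_powr_complex tendsto_add tendsto_const)
    have "((\<lambda>s. (of_real y + z) * of_real (1 / (s - y))) \<longlongrightarrow> (of_real y + z) * of_real 0) at_top"
      by (intro tendsto_mult tendsto_const tendsto_of_real) real_asymp
    then show "((\<lambda>s. (of_real y + z) / of_real (s - y)) \<longlongrightarrow> 0) at_top"
      by simp
  qed auto
  moreover have "eventually (\<lambda>s. (1 + (of_real y + z) / of_real (s - y)) powr of_real (- b)
     = of_real ((s - y) powr b) * (of_real s + z) powr of_real (- b)) at_top"
    using eventually_gt_at_top[of y] eventually_gt_at_top[of "- Re z"]
  proof eventually_elim
    case (elim s)
    then have nz: "of_real s + z \<noteq> 0"
      by (auto simp: complex_eq_iff)
    have "1 + (of_real y + z) / of_real (s - y) = of_real (1 / (s - y)) * (of_real s + z)"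
      using elim by (simp add: field_simps)
    \<comment> \<open>A positive real factor does not change the argument, so here the principal
      logarithm is additive.\<close>
    moreover have "Ln (of_real (1 / (s - y)) * (of_real s + z)) = of_real (ln (1 / (s - y))) + Ln (of_real s + z)"
      using elim nz by (subst Ln_times_of_real) (auto simp: Ln_of_real simp del: of_real_divide of_real_diff)
    moreover have "of_real (1 / (s - y)) * (of_real s + z) \<noteq> 0"
      using elim nz by simp
    ultimately show ?case
      using elim nz
      by (auto simp: powr_def ln_div exp_add[symmetric] ring_distribs simp flip: exp_of_real)
  qed
  ultimately show ?thesis
    by (auto intro: Lim_transform_eventually)
qed

lemma not_nonpos_add_imaginary:
  "t > 0 \<Longrightarrow> complex_of_real s + \<i> * complex_of_real t \<notin> \<real>\<^sub>\<le>\<^sub>0"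
  by (auto simp: complex_nonpos_Reals_iff)

lemma tendsto_powr_diff_at_right: "b > 0 \<Longrightarrow> ((\<lambda>s. (s - y) powr b) \<longlongrightarrow> (0::real)) (at_right y)"
  by (rule tendsto_zero_powrI[where b = b])
    (auto intro!: tendsto_eq_intros simp: eventually_at_filter)

text \<open>This supplies the real majorant for the complex integrand below. The exponents are those
  for which v^a / (a (y+t)), with v = (s-y)/(s+t), is an antiderivative. Since the integrand is
  nonnegative, the fundamental theorem gives integrability together with the value.\<close>

lemma
  fixes a t y :: real
  assumes "a > 0" "t > 0" "y \<ge> 0"
  shows set_integrable_powr_quotient:
      "set_integrable lborel {y<..} (\<lambda>s. (s - y) powr (a - 1) * (s + t) powr (- a - 1))"
    and integral_powr_quotient:
      "(LINT s:{y<..}|lborel. (s - y) powr (a - 1) * (s + t) powr (- a - 1)) = 1 / (a * (y + t))"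
proof -
  let ?f = "\<lambda>s. (s - y) powr (a - 1) * (s + t) powr (- a - 1)"
  let ?F = "\<lambda>s. (s - y) powr a * (s + t) powr (- a) / (a * (y + t))"
  \<comment> \<open>For s > y the base s+t is positive, so complex and real powers agree and the
    complex antiderivative can be reused.\<close>
  have real: "of_real ((s - y) powr b) * (of_real s + of_real t) powr of_real c
      = complex_of_real ((s - y) powr b * (s + t) powr c)" if "s > y" for s b c :: real
    using that assms by (simp add: powr_of_real flip: of_real_add)
  have deriv: "(?F has_real_derivative ?f s) (at s)" if "s > y" for s
  proof -
    have "complex_of_real s + of_real t \<notin> \<real>\<^sub>\<le>\<^sub>0"
      using that assms by (auto simp: complex_nonpos_Reals_iff)
    from bounded_linear.has_vector_derivative[OF bounded_linear_Re
        has_vector_derivative_powr_quotient[OF assms(1) that this]]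
    have "((\<lambda>s. Re (of_real ((s - y) powr a) * (of_real s + of_real t) powr of_real (- a) / of_real a))
        has_vector_derivative ?f s * (y + t)) (at s)"
      unfolding real[OF that] by simp
    then have "((\<lambda>s. (s - y) powr a * (s + t) powr (- a) / a)
        has_vector_derivative ?f s * (y + t)) (at s)"
    proof (rule has_vector_derivative_transform_within_open[where S = "{y<..}"])
      fix r assume "r \<in> {y<..}"
      then show "Re (of_real ((r - y) powr a) * (of_real r + of_real t) powr of_real (- a) / of_real a)
          = (r - y) powr a * (r + t) powr (- a) / a"
        using real[of r a "- a"] by (simp flip: of_real_mult of_real_divide of_real_minus)
    qed (use that in auto)
    then have "((\<lambda>s. (s - y) powr a * (s + t) powr (- a) / a) has_real_derivative ?f s * (y + t)) (at s)"
      by (simp add: has_real_derivative_iff_has_vector_derivative)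
    from DERIV_cdivide[OF this, of "y + t"] show ?thesis
      using assms by (simp add: mult_ac)
  qed
  have cont: "isCont ?f s" if "s > y" for s
    using that assms by (intro continuous_intros) auto
  have lower: "((?F \<circ> real_of_ereal) \<longlongrightarrow> 0) (at_right (ereal y))"
  proof -
    have "(?F \<longlongrightarrow> 0 * (y + t) powr (- a) / (a * (y + t))) (at_right y)"
      using assms by (intro tendsto_intros tendsto_powr_diff_at_right) auto
    then show ?thesis
      by (simp add: ereal_tendsto_simps)
  qed
  have upper: "((?F \<circ> real_of_ereal) \<longlongrightarrow> 1 / (a * (y + t))) (at_left \<infinity>)"
  proof -
    have "((\<lambda>s. Re (of_real ((s - y) powr a) * (of_real s + of_real t) powr of_real (- a)) / (a * (y + t)))
        \<longlongrightarrow> Re 1 / (a * (y + t))) at_top"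
      using assms by (intro tendsto_intros tendsto_powr_quotient_at_top) auto
    moreover have "\<forall>\<^sub>F s in at_top. Re (of_real ((s - y) powr a) * (of_real s + of_real t) powr of_real (- a)) / (a * (y + t)) = ?F s"
      using eventually_gt_at_top[of y]
    proof eventually_elim
      case (elim s)
      then show ?case using real[of s a "- a"] by (simp flip: of_real_mult)
    qed
    ultimately show ?thesis
      by (simp add: ereal_tendsto_simps Lim_transform_eventually)
  qed
  have "set_integrable lborel (einterval y \<infinity>) ?f"
    "(LBINT s=y..\<infinity>. ?f s) = 1 / (a * (y + t)) - 0"
    using deriv cont
    by (intro interval_integral_FTC_nonneg[OF _ _ _ _ lower upper]; simp)+
  then show "set_integrable lborel {y<..} ?f" "(LINT s:{y<..}|lborel. ?f s) = 1 / (a * (y + t))"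
    by (simp_all add: interval_lebesgue_integral_def set_lebesgue_integral_def einterval_eq)
qed

text \<open>The value is B(a,2) / w(y)^2. The integrand has no sign, so integrability is obtained
  first, by comparison with the real majorant, and the fundamental theorem then only evaluates. The
  norm bound is independent of y, as the later interchange of integrals requires.\<close>

lemma
  fixes a t y :: real
  assumes "a > 0" "t > 0" "y \<ge> 0"
  defines "w \<equiv> \<lambda>s. complex_of_real s + \<i> * complex_of_real t"
  shows set_integrable_powr_complex_quotient:
      "set_integrable lborel {y<..} (\<lambda>s. of_real ((s - y) powr (a - 1)) * w s powr of_real (- (a + 2)))"
    and integral_powr_complex_quotient:
      "(LINT s:{y<..}|lborel. of_real ((s - y) powr (a - 1)) * w s powr of_real (- (a + 2)))
        = 1 / (of_real (a * (a + 1)) * (w y)\<^sup>2)"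
    and integral_norm_powr_complex_quotient_le:
      "(LINT s:{y<..}|lborel. cmod (of_real ((s - y) powr (a - 1)) * w s powr of_real (- (a + 2))))
        \<le> 2 powr (a + 1) / (a * t\<^sup>2)"
proof -
  let ?f = "\<lambda>s. of_real ((s - y) powr (a - 1)) * w s powr of_real (- (a + 2))"
  let ?g = "\<lambda>s. 2 powr (a + 1) / t * ((s - y) powr (a - 1) * (s + t) powr (- a - 1))"
  have w: "w s \<notin> \<real>\<^sub>\<le>\<^sub>0" for s
    unfolding w_def by (rule not_nonpos_add_imaginary) fact
  have w0: "w s \<noteq> 0" for s
    using w[of s] by auto
  have le: "cmod (?f s) \<le> ?g s" if "s > y" for s
  proof -
    \<comment> \<open>The exponent -(a+2) is split as (-a-1) + (-1): the first part is compared with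
      (s+t)/2, which produces 2^(a+1), and the second with 1/t.\<close>
    have "s + t \<le> 2 * cmod (w s)" "t \<le> cmod (w s)"
      using abs_Re_le_cmod[of "w s"] abs_Im_le_cmod[of "w s"] by (simp_all add: w_def)
    moreover from this(1) have "cmod (w s) powr (- a - 1) \<le> ((s + t) / 2) powr (- a - 1)"
      using assms that by (intro powr_mono2') auto
    ultimately have "cmod (w s) powr (- a - 1) * (1 / cmod (w s)) \<le> ((s + t) / 2) powr (- a - 1) * (1 / t)"
      using assms by (intro mult_mono divide_left_mono) (auto intro!: mult_pos_pos simp: w0)
    moreover have "cmod (w s) powr (- (a + 2)) = cmod (w s) powr (- a - 1) * (1 / cmod (w s))"
      using w0[of s] by (simp add: powr_diff powr_minus powr_add divide_simps power2_eq_square)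
    moreover have "((s + t) / 2) powr (- a - 1) = 2 powr (a + 1) * (s + t) powr (- a - 1)"
    proof -
      have "2 powr (- a - 1) = 1 / 2 powr (a + 1)"
        using powr_minus_divide[of 2 "a + 1"] by simp
      then show ?thesis using assms that by (simp add: powr_divide)
    qed
    ultimately have "cmod (w s) powr (- (a + 2)) \<le> 2 powr (a + 1) * (s + t) powr (- a - 1) * (1 / t)"
      by simp
    then have "(s - y) powr (a - 1) * cmod (w s) powr (- (a + 2))
        \<le> (s - y) powr (a - 1) * (2 powr (a + 1) * (s + t) powr (- a - 1) * (1 / t))"
      by (intro mult_left_mono) auto
    then show ?thesis
      unfolding norm_mult by (simp add: norm_powr_real_powr' mult_ac)
  qed
  have meas[measurable]: "?f \<in> borel_measurable borel"
  proof -
    have "continuous_on UNIV (\<lambda>s. w s powr of_real (- (a + 2)))"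
      unfolding w_def using \<open>t > 0\<close> by (intro continuous_intros) (auto simp: complex_eq_iff)
    then have [measurable]: "(\<lambda>s. w s powr of_real (- (a + 2))) \<in> borel_measurable borel"
      by (rule borel_measurable_continuous_onI)
    show ?thesis by measurable
  qed
  have int_g: "set_integrable lborel {y<..} ?g"
    by (intro set_integrable_mult_right set_integrable_powr_quotient assms)
  show int: "set_integrable lborel {y<..} ?f"
    using int_g
  proof (rule set_integrable_bound)
    show "set_borel_measurable lborel {y<..} ?f"
      unfolding set_borel_measurable_def by measurable
    have "cmod (?f s) \<le> norm (?g s)" if "s > y" for s
      unfolding real_norm_def by (rule order_trans[OF le[OF that] abs_ge_self])
    then show "AE s in lborel. s \<in> {y<..} \<longrightarrow> cmod (?f s) \<le> norm (?g s)"
      by (intro AE_I2) auto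
  qed
  have "(LINT s:{y<..}|lborel. cmod (?f s)) \<le> (LINT s:{y<..}|lborel. ?g s)"
    using le by (intro set_integral_mono int_g set_integrable_norm int) auto
  also have "\<dots> = 2 powr (a + 1) / t * (1 / (a * (y + t)))"
    using assms by (simp add: integral_powr_quotient)
  \<comment> \<open>Replacing y+t by t makes the bound uniform in y.\<close>
  also have "\<dots> \<le> 2 powr (a + 1) / t * (1 / (a * t))"
    using assms by (intro mult_left_mono divide_left_mono mult_pos_pos) auto
  finally show "(LINT s:{y<..}|lborel. cmod (?f s)) \<le> 2 powr (a + 1) / (a * t\<^sup>2)"
    by (simp add: power2_eq_square mult_ac)

  \<comment> \<open>With $v = (s-y)/w(s)$ the integrand is $v^{a-1}(1-v)\,dv$ divided by $w(y)^2$.\<close>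
  define G where "G = (\<lambda>b s. of_real ((s - y) powr b) * w s powr of_real (- b) / of_real b)"
  let ?F = "\<lambda>s. (G a s - G (a + 1) s) / (w y)\<^sup>2"
  have deriv: "(?F has_vector_derivative ?f s) (at s)" if "s > y" for s
  proof -
    have "(G b has_vector_derivative of_real ((s - y) powr (b - 1)) * w s powr of_real (- b - 1) * w y) (at s)"
      if "b > 0" for b
      unfolding G_def w_def
      by (rule has_vector_derivative_powr_quotient) (use that w \<open>s > y\<close> in \<open>auto simp: w_def\<close>)
    from has_vector_derivative_divide[OF has_vector_derivative_diff[OF this[of a] this[of "a + 1"]], of "(w y)\<^sup>2"]
    have d: "(?F has_vector_derivative
       (of_real ((s - y) powr (a - 1)) * w s powr of_real (- a - 1) * w y
        - of_real ((s - y) powr (a + 1 - 1)) * w s powr of_real (- (a + 1) - 1) * w y) / (w y)\<^sup>2) (at s)"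
      using assms by auto
    have p: "(s - y) powr (a + 1 - 1) = (s - y) powr (a - 1) * (s - y)"
      using that by (simp add: powr_diff)
    have q: "w s powr of_real (- a - 1) = w s powr of_real (- (a + 2)) * w s"
    proof -
      have "complex_of_real (- a - 1) = of_real (- (a + 2)) + 1"
        by simp
      then show ?thesis
        using w0[of s] by (simp only: powr_add powr_to_1 if_False simp_thms)
    qed
    have r: "w s powr of_real (- (a + 1) - 1) = w s powr of_real (- (a + 2))"
      by (simp add: algebra_simps)
    \<comment> \<open>The two terms of the derivative differ by the factor w(s) - (s-y). It equals
      w(y), and with the common factor w(y) it cancels the denominator w(y)^2.\<close>
    have wy: "w s - of_real (s - y) = w y"
      by (simp add: w_def)
    have "of_real ((s - y) powr (a - 1)) * w s powr of_real (- a - 1) * w y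
        - of_real ((s - y) powr (a + 1 - 1)) * w s powr of_real (- (a + 1) - 1) * w y
      = ?f s * ((w s - of_real (s - y)) * w y)"
      unfolding p q r of_real_mult by (simp add: algebra_simps)
    with d show ?thesis
      unfolding wy using w0[of y] by (simp add: power2_eq_square)
  qed
  have cont: "isCont ?f s" if "s > y" for s
    using that w[of s] unfolding w_def by (intro continuous_intros) auto
  have lower: "((?F \<circ> real_of_ereal) \<longlongrightarrow> 0) (at_right (ereal y))"
  proof -
    have "(G b \<longlongrightarrow> of_real 0 * w y powr of_real (- b) / of_real b) (at_right y)" if "b > 0" for b
      unfolding G_def using that w[of y] unfolding w_def
      by (intro tendsto_intros tendsto_powr_complex tendsto_powr_diff_at_right) auto
    from tendsto_divide[OF tendsto_diff[OF this[of a] this[of "a + 1"]] tendsto_const[of "(w y)\<^sup>2"]]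
    show ?thesis
      using assms w0[of y] by (simp add: ereal_tendsto_simps)
  qed
  have upper: "((?F \<circ> real_of_ereal) \<longlongrightarrow> (1 / of_real a - 1 / of_real (a + 1)) / (w y)\<^sup>2) (at_left \<infinity>)"
  proof -
    have "(G b \<longlongrightarrow> 1 / of_real b) at_top" if "b > 0" for b
      unfolding G_def w_def using that
      by (intro tendsto_intros tendsto_powr_quotient_at_top) auto
    from tendsto_divide[OF tendsto_diff[OF this[of a] this[of "a + 1"]] tendsto_const[of "(w y)\<^sup>2"]]
    show ?thesis
      using assms w0[of y] by (simp add: ereal_tendsto_simps)
  qed
  have "set_integrable lborel (einterval y \<infinity>) ?f"
    using int by (simp add: einterval_eq)
  then have "(LBINT s=y..\<infinity>. ?f s) = (1 / of_real a - 1 / of_real (a + 1)) / (w y)\<^sup>2 - 0"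
    using deriv cont by (intro interval_integral_FTC_integrable[OF _ _ _ _ lower upper]) simp_all
  also have "\<dots> = 1 / (of_real (a * (a + 1)) * (w y)\<^sup>2)"
  proof -
    have "complex_of_real a \<noteq> 0" "complex_of_real a + 1 \<noteq> 0"
      using assms by (auto simp: complex_eq_iff)
    then show ?thesis
      using w0[of y] by (simp add: field_simps)
  qed
  finally show "(LINT s:{y<..}|lborel. ?f s) = 1 / (of_real (a * (a + 1)) * (w y)\<^sup>2)"
    by (simp add: interval_lebesgue_integral_def einterval_eq)
qed

subsection \<open>Poisson derivatives as superpositions of dilates\<close>

lemma phi_dil_uminus: "phi_dil a s (- y) = - phi_dil a s y"
proof -
  have "indicator {0..1} (- x) = (indicator {-1..0} x :: real)"
    "indicator {-1..0} (- x) = (indicator {0..1} x :: real)" for x :: real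
    by (auto simp: indicator_def)
  then show ?thesis
    by (simp add: phi_dil_def phi_def right_diff_distrib diff_divide_distrib)
qed

text \<open>Both indicators are 1 at the origin and cancel.\<close>

lemma phi_dil_zero: "phi_dil a s 0 = 0"
  by (simp add: phi_dil_def phi_def)

text \<open>For s > y > 0 the dilate is a s^{-a} (s-y)^{a-1}, and its power of s cancels the factor
  \<open>s powr a\<close> of the weight.\<close>

lemma phi_dil_weight:
  assumes "y > 0" "s > 0" "a > 0"
  shows "phi_dil a s y * weight a t s
    = indicator {y<..} s * (a * (a + 1) / pi * t *
        Im (of_real ((s - y) powr (a - 1)) * (complex_of_real s + \<i> * complex_of_real t) powr of_real (- (a + 2))))"
proof -
  \<comment> \<open>For s < y the point y/s lies outside the support; at s = y the convention
    \<open>0 powr b = 0\<close> makes the left side vanish, in agreement with the open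
    half-line.\<close>
  consider "s < y" | "s = y" | "s > y" by linarith
  then show ?thesis
  proof cases
    case 3
    have "\<bar>1 - \<bar>y / s\<bar>\<bar> = (s - y) / s"
      using assms 3 by (simp add: field_simps)
    moreover have "indicator {0..1} (y / s) = (1 :: real)" "indicator {-1..0} (y / s) = (0 :: real)"
      using assms 3 by (simp_all add: indicator_def not_le)
    ultimately have "phi_dil a s y * s powr a = a * (s - y) powr (a - 1)"
      using assms 3 by (simp add: phi_dil_def phi_def powr_divide powr_diff)
    then show ?thesis
      using 3 by (simp add: weight_def ac_simps)
  qed (use assms in \<open>auto simp: phi_dil_def phi_def indicator_def divide_simps\<close>)
qed

text \<open>For y > 0 take imaginary parts in the Beta integral: Im (1 / w(y)^2) = -2yt /
  (y^2+t^2)^2, which is pi times \<open>cauchy_density_deriv t y\<close>. Negative y reduce to this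
  by oddness, and at y = 0 everything vanishes. The bound on the absolute integral is independent of
  y, for use with Fubini's theorem.\<close>

lemma
  assumes "a > 0" "t > 0"
  shows integrable_phi_dil_weight:
      "integrable lborel (\<lambda>s. indicator {0<..} s * (phi_dil a s y * weight a t s))"
    and integral_phi_dil_weight:
      "(\<integral>s. indicator {0<..} s * (phi_dil a s y * weight a t s) \<partial>lborel)
        = t * cauchy_density_deriv t y"
    and integral_abs_phi_dil_weight_le:
      "(\<integral>s. \<bar>indicator {0<..} s * (phi_dil a s y * weight a t s)\<bar> \<partial>lborel)
        \<le> (a + 1) * 2 powr (a + 1) / (pi * t)"
proof -
  let ?h = "\<lambda>y s. indicator {0<..} s * (phi_dil a s y * weight a t s)"
  define B where "B = (a + 1) * 2 powr (a + 1) / (pi * t)"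
  have "B \<ge> 0"
    using assms by (simp add: B_def)
  have pos: "integrable lborel (?h y) \<and> (\<integral>s. ?h y s \<partial>lborel) = t * cauchy_density_deriv t y
      \<and> (\<integral>s. \<bar>?h y s\<bar> \<partial>lborel) \<le> B" if "y > 0" for y
  proof -
    define w where "w s = complex_of_real s + \<i> * complex_of_real t" for s
    let ?k = "\<lambda>s. of_real ((s - y) powr (a - 1)) * w s powr of_real (- (a + 2))"
    let ?c = "a * (a + 1) / pi * t"
    have h: "?h y s = ?c * Im (indicator {y<..} s *\<^sub>R ?k s)" for s
      using phi_dil_weight[OF \<open>y > 0\<close> _ \<open>a > 0\<close>, of s t] that
      by (auto simp: w_def indicator_def)
    have int: "integrable lborel (\<lambda>s. indicator {y<..} s *\<^sub>R ?k s)"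
      using set_integrable_powr_complex_quotient[of a t y] assms that by (simp add: set_integrable_def w_def)
    have "integrable lborel (?h y)"
      unfolding h by (intro integrable_mult_right integrable_Im int)
    moreover have "(\<integral>s. ?h y s \<partial>lborel) = ?c * Im (LINT s:{y<..}|lborel. ?k s)"
      unfolding h set_lebesgue_integral_def integral_mult_right_zero integral_Im[OF int] ..
    then have "(\<integral>s. ?h y s \<partial>lborel) = t * cauchy_density_deriv t y"
    proof -
      have "(w y)\<^sup>2 * (cnj (w y))\<^sup>2 = of_real ((y\<^sup>2 + t\<^sup>2)\<^sup>2)"
        by (simp add: complex_eq_iff w_def power2_eq_square algebra_simps)
      moreover have "1 / (w y)\<^sup>2 = (cnj (w y))\<^sup>2 / ((w y)\<^sup>2 * (cnj (w y))\<^sup>2)"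
      proof -
        have "w y \<noteq> 0"
          using assms by (auto simp: w_def complex_eq_iff)
        then show ?thesis by simp
      qed
      ultimately have "1 / (w y)\<^sup>2 = (cnj (w y))\<^sup>2 / of_real ((y\<^sup>2 + t\<^sup>2)\<^sup>2)"
        by simp
      then have "Im (1 / (w y)\<^sup>2) = - (2 * y * t) / (y\<^sup>2 + t\<^sup>2)\<^sup>2"
        by (simp add: w_def power2_eq_square)
      moreover have "Im (of_real r * z) = r * Im z" for r z
        by simp
      moreover have "1 / (of_real (a * (a + 1)) * (w y)\<^sup>2) = of_real (1 / (a * (a + 1))) * (1 / (w y)\<^sup>2)"
        by simp
      ultimately have "Im (1 / (of_real (a * (a + 1)) * (w y)\<^sup>2))
          = 1 / (a * (a + 1)) * (- (2 * y * t) / (y\<^sup>2 + t\<^sup>2)\<^sup>2)"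
        by (simp only:)
      then show ?thesis
        using integral_powr_complex_quotient[of a t y] assms that
          \<open>(\<integral>s. ?h y s \<partial>lborel) = ?c * Im (LINT s:{y<..}|lborel. ?k s)\<close>
        by (simp add: cauchy_density_deriv_def flip: w_def)
    qed
    moreover have "(\<integral>s. \<bar>?h y s\<bar> \<partial>lborel) \<le> (\<integral>s. ?c * cmod (indicator {y<..} s *\<^sub>R ?k s) \<partial>lborel)"
    proof (intro integral_mono)
      have "\<bar>?c * Im z\<bar> \<le> ?c * cmod z" for z
        using assms unfolding abs_mult by (intro mult_mono) (auto simp: abs_Im_le_cmod)
      then show "\<bar>?h y s\<bar> \<le> ?c * cmod (indicator {y<..} s *\<^sub>R ?k s)" for s
        unfolding h .
      show "integrable lborel (\<lambda>s. \<bar>?h y s\<bar>)"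
        by (intro integrable_abs) fact
      show "integrable lborel (\<lambda>s. ?c * cmod (indicator {y<..} s *\<^sub>R ?k s))"
        by (intro integrable_mult_right integrable_norm int)
    qed
    moreover have "(\<integral>s. ?c * cmod (indicator {y<..} s *\<^sub>R ?k s) \<partial>lborel)
        = ?c * (LINT s:{y<..}|lborel. cmod (?k s))"
      by (simp add: set_lebesgue_integral_def)
    moreover have "?c * (LINT s:{y<..}|lborel. cmod (?k s)) \<le> ?c * (2 powr (a + 1) / (a * t\<^sup>2))"
      using integral_norm_powr_complex_quotient_le[of a t y] assms that
      by (intro mult_left_mono) (auto simp: w_def)
    moreover have "?c * (2 powr (a + 1) / (a * t\<^sup>2)) = B"
      using assms by (simp add: B_def power2_eq_square)
    ultimately show ?thesis
      by (intro conjI; (assumption | linarith))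
  qed
  have "integrable lborel (?h y) \<and> (\<integral>s. ?h y s \<partial>lborel) = t * cauchy_density_deriv t y
      \<and> (\<integral>s. \<bar>?h y s\<bar> \<partial>lborel) \<le> B"
  proof -
    consider "y > 0" | "y = 0" | "- y > 0" by linarith
    then show ?thesis
    proof cases
      case 3
      have "?h y = (\<lambda>s. - ?h (- y) s)"
        by (simp add: phi_dil_uminus)
      moreover have "\<bar>?h y s\<bar> = \<bar>?h (- y) s\<bar>" for s
        by (simp add: phi_dil_uminus)
      ultimately show ?thesis
        using pos[OF 3] by (simp add: cauchy_density_deriv_def)
    qed (use pos \<open>B \<ge> 0\<close> in \<open>auto simp: phi_dil_zero cauchy_density_deriv_def\<close>)
  qed
  then show "integrable lborel (?h y)" "(\<integral>s. ?h y s \<partial>lborel) = t * cauchy_density_deriv t y"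
    "(\<integral>s. \<bar>?h y s\<bar> \<partial>lborel) \<le> (a + 1) * 2 powr (a + 1) / (pi * t)"
    by (simp_all add: B_def)
qed

text \<open>Since s \<le> |s+it|, the factor s^a is absorbed by a of the a+2 orders of decay, and
  |s+it|^{-2} = 1/(s^2+t^2) is left.\<close>

lemma abs_weight_le:
  assumes "a > 0" "t > 0" "s > 0"
  shows "\<bar>weight a t s\<bar> \<le> (a + 1) * cauchy_density t s"
proof -
  define w where "w = complex_of_real s + \<i> * complex_of_real t"
  have w0: "w \<noteq> 0" and sq: "(cmod w)\<^sup>2 = s\<^sup>2 + t\<^sup>2"
    using assms by (auto simp: w_def complex_eq_iff cmod_power2)
  have "s powr a \<le> cmod w powr a"
    using abs_Re_le_cmod[of w] assms by (intro powr_mono2) (auto simp: w_def)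
  have "\<bar>Im (w powr of_real (- (a + 2)))\<bar> \<le> cmod w powr (- (a + 2))"
    using abs_Im_le_cmod[of "w powr of_real (- (a + 2))"] by (simp add: norm_powr_real_powr')
  then have "s powr a * \<bar>Im (w powr of_real (- (a + 2)))\<bar> \<le> cmod w powr a * cmod w powr (- (a + 2))"
    using \<open>s powr a \<le> _\<close> by (intro mult_mono) auto
  also have "\<dots> = 1 / (s\<^sup>2 + t\<^sup>2)"
  proof -
    have "cmod w powr a * cmod w powr (- (a + 2)) = cmod w powr (- 2)"
      by (simp flip: powr_add)
    also have "\<dots> = 1 / (cmod w)\<^sup>2"
      using w0 by (simp add: powr_minus_divide)
    finally show ?thesis
      by (simp only: sq)
  qed
  finally have "(a + 1) / pi * t * (s powr a * \<bar>Im (w powr of_real (- (a + 2)))\<bar>)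
      \<le> (a + 1) / pi * t * (1 / (s\<^sup>2 + t\<^sup>2))"
    using assms by (intro mult_left_mono) auto
  then show ?thesis
    using assms by (simp add: weight_def cauchy_density_def abs_mult w_def mult_ac)
qed

lemma measurable_weight [measurable]:
  assumes "t > 0"
  shows "weight a t \<in> borel_measurable borel"
proof -
  have "continuous_on UNIV (\<lambda>s. (complex_of_real s + \<i> * complex_of_real t) powr of_real (- (a + 2)))"
    using assms by (intro continuous_intros) (auto simp: complex_eq_iff)
  then have [measurable]: "(\<lambda>s. (complex_of_real s + \<i> * complex_of_real t) powr of_real (- (a + 2))) \<in> borel_measurable borel"
    by (rule borel_measurable_continuous_onI)
  show ?thesis
    unfolding weight_def[abs_def] by measurable
qed

subsection \<open>Integration over coordinates\<close>

lemma prod_Basis_vec: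
  "(\<Prod>b\<in>(Basis :: (real ^ 'n::finite) set). h b) = (\<Prod>i\<in>UNIV. h (axis i 1))"
proof -
  have "(Basis :: (real ^ 'n) set) = range (\<lambda>i. axis i 1)"
    by (auto simp: Basis_vec_def)
  moreover have "inj (\<lambda>i::'n. axis i (1::real))"
    by (auto simp: inj_on_def axis_eq_axis)
  then have "prod h (range (\<lambda>i. axis i 1)) = prod (h \<circ> (\<lambda>i::'n. axis i 1)) UNIV"
    by (rule prod.reindex)
  ultimately show ?thesis
    by (simp add: comp_def)
qed

lemma nn_integral_lborel_prod_vec:
  fixes f :: "'n::finite \<Rightarrow> real \<Rightarrow> real"
  assumes [measurable]: "\<And>i. f i \<in> borel_measurable borel" and nn: "\<And>i x. 0 \<le> f i x"
  shows "(\<integral>\<^sup>+x. ennreal (\<Prod>i\<in>UNIV. f i ((x :: real ^ 'n) $ i)) \<partial>lborel)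
    = (\<Prod>i\<in>UNIV. \<integral>\<^sup>+x. ennreal (f i x) \<partial>lborel)"
proof -
  have "(\<integral>\<^sup>+x. (\<Prod>b\<in>(Basis :: (real ^ 'n) set). ennreal (f (axis_index b) (x \<bullet> b))) \<partial>lborel)
      = (\<Prod>b\<in>(Basis :: (real ^ 'n) set). \<integral>\<^sup>+x. ennreal (f (axis_index b) x) \<partial>lborel)"
    by (rule nn_integral_lborel_prod) auto
  then show ?thesis
    by (simp add: prod_Basis_vec inner_axis prod_ennreal nn)
qed

text \<open>\<open>lborel\<close> is the image of the product measure over \<open>Basis\<close>
  under assembling a vector from its coordinates, so the Fubini theorems for finite products
  transfer. The factors may change sign, as the dilates do.\<close>

lemma
  fixes f :: "'n::finite \<Rightarrow> real \<Rightarrow> real"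
  assumes f: "\<And>i. integrable lborel (f i)"
  shows integrable_lborel_prod_vec: "integrable lborel (\<lambda>x :: real ^ 'n. \<Prod>i\<in>UNIV. f i (x $ i))"
    and integral_lborel_prod_vec:
      "(\<integral>x. (\<Prod>i\<in>UNIV. f i ((x :: real ^ 'n) $ i)) \<partial>lborel) = (\<Prod>i\<in>UNIV. \<integral>x. f i x \<partial>lborel)"
proof -
  interpret product_sigma_finite "\<lambda>_ :: real ^ 'n. lborel :: real measure" ..
  let ?B = "Basis :: (real ^ 'n) set"
  let ?g = "\<lambda>x :: real ^ 'n. \<Prod>b\<in>?B. f (axis_index b) (x \<bullet> b)"
  have g: "(\<lambda>x. \<Prod>i\<in>UNIV. f i (x $ i)) = ?g"
    by (simp add: prod_Basis_vec inner_axis)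
  have [measurable]: "f i \<in> borel_measurable borel" for i
    using borel_measurable_integrable[OF f] by simp
  have inner: "(\<Prod>b\<in>?B. f (axis_index b) ((\<Sum>b\<in>?B. y b *\<^sub>R b) \<bullet> b))
      = (\<Prod>b\<in>?B. f (axis_index b) (y b))" for y
    by (rule prod.cong) auto
  have "integrable (distr (\<Pi>\<^sub>M b\<in>?B. lborel) borel (\<lambda>y. \<Sum>b\<in>?B. y b *\<^sub>R b)) ?g"
    by (subst integrable_distr_eq) (auto simp: inner intro!: product_integrable_prod f)
  then show "integrable lborel (\<lambda>x :: real ^ 'n. \<Prod>i\<in>UNIV. f i (x $ i))"
    unfolding g by (simp flip: lborel_eq)
  have "integral\<^sup>L (distr (\<Pi>\<^sub>M b\<in>?B. lborel) borel (\<lambda>y. \<Sum>b\<in>?B. y b *\<^sub>R b)) ?g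
      = (\<Prod>b\<in>?B. \<integral>x. f (axis_index b) x \<partial>lborel)"
    by (subst integral_distr) (auto simp: inner intro!: product_integral_prod f)
  then show "(\<integral>x. (\<Prod>i\<in>UNIV. f i ((x :: real ^ 'n) $ i)) \<partial>lborel) = (\<Prod>i\<in>UNIV. \<integral>x. f i x \<partial>lborel)"
    unfolding g by (simp add: prod_Basis_vec flip: lborel_eq)
qed

lemma lborel_distr_reflect: "distr lborel borel (\<lambda>y. x - y) = (lborel :: 'a::euclidean_space measure)"
  using lborel_affine[of "-1" x] by (simp add: density_1)

lemma integral_lborel_reflect:
  fixes f :: "'a::euclidean_space \<Rightarrow> complex"
  assumes [measurable]: "f \<in> borel_measurable borel"
  shows "(\<integral>y. f (x - y) \<partial>lborel) = (\<integral>y. f y \<partial>lborel)"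
  by (subst (2) lborel_distr_reflect[of x, symmetric]) (simp add: integral_distr)

lemma integrable_lborel_reflect:
  fixes f :: "'a::euclidean_space \<Rightarrow> complex"
  assumes "integrable lborel f"
  shows "integrable lborel (\<lambda>y. f (x - y))"
proof -
  have "integrable (distr lborel borel (\<lambda>y. x - y)) f"
    using assms by (simp add: lborel_distr_reflect)
  then show ?thesis
    using borel_measurable_integrable[OF assms] by (subst (asm) integrable_distr_eq) auto
qed

section \<open>Integrability of Schwartz functions\<close>

text \<open>This converts decay in the norm, as the Schwartz seminorms give it, into decay in each
  coordinate separately. Each factor is at most twice the larger of 1 and the squared norm.\<close>

lemma prod_one_add_power2_le:
  "(\<Prod>i\<in>UNIV. 1 + (x $ i)\<^sup>2) \<le> 2 ^ CARD('n) * (1 + norm x ^ (2 * CARD('n)))"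
  for x :: "real ^ 'n::finite"
proof -
  let ?n = "CARD('n)" and ?r = "max 1 ((norm x)\<^sup>2)"
  have "(\<Prod>i\<in>UNIV. 1 + (x $ i)\<^sup>2) \<le> (\<Prod>i\<in>(UNIV::'n set). 2 * ?r)"
  proof (intro prod_mono conjI)
    fix i
    have "(x $ i)\<^sup>2 \<le> (norm x)\<^sup>2"
      using component_le_norm_cart[of x i] by (metis abs_norm_cancel abs_le_square_iff)
    then show "1 + (x $ i)\<^sup>2 \<le> 2 * ?r"
      by linarith
  qed simp
  also have "\<dots> = 2 ^ ?n * ?r ^ ?n"
    by (simp add: power_mult_distrib)
  also have "\<dots> \<le> 2 ^ ?n * (1 + norm x ^ (2 * ?n))"
    by (intro mult_left_mono) (auto simp: max_def power_mult)
  finally show ?thesis .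
qed

lemma schwartz_measurable:
  assumes "f \<in> schwartz"
  shows "f \<in> borel_measurable borel"
proof -
  from assms have "partials [] f differentiable (at x)" for x
    unfolding schwartz_def by blast
  then have "continuous_on UNIV f"
    by (simp add: partials_def continuous_at_imp_continuous_on differentiable_imp_continuous_within)
  then show ?thesis
    by (rule borel_measurable_continuous_onI)
qed

text \<open>The seminorms without derivatives dominate f by a multiple of a product of Cauchy
  densities of scale 1. Integrability is the form in which the hypothesis on f enters the
  estimates.\<close>

lemma integrable_schwartz:
  fixes f :: "real ^ 'n::finite \<Rightarrow> complex"
  assumes f: "f \<in> schwartz"
  shows "integrable lborel f"
proof -
  let ?n = "CARD('n)"
  note [measurable] = schwartz_measurable[OF f]
  have "bounded (range (\<lambda>x. norm x ^ k *\<^sub>R partials [] f x))" for k :: nat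
    using f unfolding schwartz_def by blast
  then have "\<exists>B. \<forall>x. norm x ^ k * cmod (f x) \<le> B" for k :: nat
    by (simp add: partials_def bounded_iff)
  then obtain B where B: "\<And>k x. norm x ^ k * cmod (f x) \<le> B k"
    by metis
  \<comment> \<open>Orders 0 and 2n are the two powers of the norm in
    \<open>prod_one_add_power2_le\<close>; the extra factor \<open>pi ^ ?n\<close> below undoes the
    normalisation of \<open>cauchy_density 1\<close>.\<close>
  let ?C = "2 ^ ?n * (B 0 + B (2 * ?n))"
  have le: "cmod (f x) \<le> ?C * pi ^ ?n * (\<Prod>i\<in>UNIV. cauchy_density 1 (x $ i))" for x
  proof -
    have pos: "0 < (\<Prod>i\<in>UNIV. 1 + (x $ i)\<^sup>2)"
      by (intro prod_pos) (auto intro: add_pos_nonneg)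
    have "(\<Prod>i\<in>UNIV. 1 + (x $ i)\<^sup>2) * cmod (f x)
        \<le> 2 ^ ?n * (1 + norm x ^ (2 * ?n)) * cmod (f x)"
      by (intro mult_right_mono prod_one_add_power2_le) auto
    also have "\<dots> = 2 ^ ?n * (norm x ^ 0 * cmod (f x) + norm x ^ (2 * ?n) * cmod (f x))"
      by (simp add: algebra_simps)
    also have "\<dots> \<le> ?C"
      by (intro mult_left_mono add_mono B) auto
    finally have "cmod (f x) \<le> ?C / (\<Prod>i\<in>UNIV. 1 + (x $ i)\<^sup>2)"
      using pos by (simp add: field_simps)
    also have "\<dots> = ?C * pi ^ ?n * (\<Prod>i\<in>UNIV. cauchy_density 1 (x $ i))"
      using pos by (simp add: cauchy_density_def prod_dividef prod.distrib add.commute)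
    finally show ?thesis .
  qed
  show ?thesis
  proof (rule Bochner_Integration.integrable_bound)
    show "integrable lborel (\<lambda>x. ?C * pi ^ ?n * (\<Prod>i\<in>UNIV. cauchy_density 1 ((x :: real ^ 'n) $ i)))"
    proof (intro integrable_mult_right integrable_lborel_prod_vec)
      show "integrable lborel (cauchy_density 1)"
        using nn_integral_cauchy_density[of 1] cauchy_density_nonneg[of 1]
        by (intro integrableI_bounded) (auto simp: cauchy_density_def[abs_def])
    qed
    show "AE x in lborel. cmod (f x) \<le> norm (?C * pi ^ ?n * (\<Prod>i\<in>UNIV. cauchy_density 1 (x $ i)))"
      unfolding real_norm_def by (intro AE_I2 order_trans[OF le abs_ge_self])
  qed simp
qed

subsection \<open>Differentiation under the integral sign\<close>

text \<open>Difference quotients pass through the integral by linearity, which makes this form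
  suitable for dominated convergence.\<close>

lemma has_vector_derivative_at_iff_quotient:
  "(f has_vector_derivative D) (at r) \<longleftrightarrow> ((\<lambda>h. (f h - f r) /\<^sub>R (h - r)) \<longlongrightarrow> D) (at r)"
proof -
  have "norm ((f h - f r) /\<^sub>R (h - r) - D) = norm (f h - f r - (h - r) *\<^sub>R D) / norm (h - r)" if "h \<noteq> r" for h
  proof -
    have "(f h - f r) /\<^sub>R (h - r) - D = (f h - f r - (h - r) *\<^sub>R D) /\<^sub>R (h - r)"
      using that by (simp add: scaleR_diff_right)
    then show ?thesis
      by (simp add: divide_inverse mult.commute)
  qed
  then have "((\<lambda>h. norm ((f h - f r) /\<^sub>R (h - r) - D)) \<longlongrightarrow> 0) (at r)
      \<longleftrightarrow> ((\<lambda>h. norm (f h - f r - (h - r) *\<^sub>R D) / norm (h - r)) \<longlongrightarrow> 0) (at r)"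
    by (intro filterlim_cong) (auto simp: eventually_at_filter)
  then show ?thesis
    by (simp add: has_vector_derivative_def has_derivative_iff_norm bounded_linear_scaleR_left
        tendsto_norm_zero_iff flip: LIM_zero_iff[of _ D])
qed

text \<open>The mean value inequality turns the bound on the derivative into the same bound B for
  all difference quotients. Dominated convergence then applies along every sequence tending to
  r.\<close>

lemma has_vector_derivative_lebesgue_integral:
  fixes G :: "real \<Rightarrow> 'a \<Rightarrow> 'b::{banach, second_countable_topology}"
  assumes int: "\<And>h. integrable M (G h)"
    and deriv: "\<And>h y. ((\<lambda>h. G h y) has_vector_derivative G' h y) (at h)"
    and meas[measurable]: "G' r \<in> borel_measurable M"
    and bound: "\<And>h y. norm (G' h y) \<le> B y"
    and B: "integrable M B"
  shows "((\<lambda>h. \<integral>y. G h y \<partial>M) has_vector_derivative (\<integral>y. G' r y \<partial>M)) (at r)"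
proof -
  let ?Q = "\<lambda>h y. (G h y - G r y) /\<^sub>R (h - r)"
  have [measurable]: "G h \<in> borel_measurable M" for h
    using int by auto
  have lim: "((\<lambda>h. ?Q h y) \<longlongrightarrow> G' r y) (at r)" for y
    using deriv[of y r] by (simp add: has_vector_derivative_at_iff_quotient)
  have le: "norm (?Q h y) \<le> B y" if "h \<noteq> r" for h y
  proof -
    have "norm (G h y - G r y) \<le> B y * norm (h - r)"
      using deriv bound
      by (intro differentiable_bound[of UNIV "\<lambda>h. G h y" "\<lambda>h k. k *\<^sub>R G' h y"])
        (auto simp: has_vector_derivative_def onorm_scaleR_left[OF bounded_linear_ident] onorm_id)
    then show ?thesis
      using that by (simp add: divide_simps abs_minus_commute mult.commute)
  qed
  have *: "((\<lambda>h. \<integral>y. ?Q h y \<partial>M) \<longlongrightarrow> (\<integral>y. G' r y \<partial>M)) (at r)"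
    unfolding tendsto_at_iff_sequentially comp_def
  proof (intro allI impI)
    fix X :: "nat \<Rightarrow> real"
    assume X: "\<forall>i. X i \<in> UNIV - {r}" "X \<longlonglongrightarrow> r"
    show "(\<lambda>i. \<integral>y. ?Q (X i) y \<partial>M) \<longlonglongrightarrow> (\<integral>y. G' r y \<partial>M)"
    proof (rule integral_dominated_convergence[where w = B])
      show "AE y in M. (\<lambda>i. ?Q (X i) y) \<longlonglongrightarrow> G' r y"
        using lim X unfolding tendsto_at_iff_sequentially comp_def by blast
      show "AE y in M. norm (?Q (X i) y) \<le> B y" for i
        using le X(1) by auto
    qed (use B in measurable)
  qed
  have Q: "(\<integral>y. ?Q h y \<partial>M) = ((\<integral>y. G h y \<partial>M) - (\<integral>y. G r y \<partial>M)) /\<^sub>R (h - r)" for h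
    by (simp add: Bochner_Integration.integral_diff[OF int int])
  show ?thesis
    using * unfolding Q has_vector_derivative_at_iff_quotient .
qed

section \<open>Mixed derivatives of the Poisson integral\<close>

text \<open>A is the set of coordinates already differentiated. A set suffices because each variable
  is differentiated at most once, and it makes the result independent of the order.\<close>

definition poisson_deriv :: "'n set \<Rightarrow> real ^ 'n::finite \<Rightarrow> real ^ 'n \<Rightarrow> real" where
  "poisson_deriv A t x =
    (\<Prod>i\<in>UNIV. if i \<in> A then cauchy_density_deriv (t $ i) (x $ i) else cauchy_density (t $ i) (x $ i))"

lemma poisson_deriv_empty: "poisson_deriv {} = poisson_kernel"
  by (simp add: fun_eq_iff poisson_deriv_def poisson_kernel_def cauchy_density_def)

lemma measurable_cauchy_density_deriv [measurable]: "cauchy_density_deriv t \<in> borel_measurable borel"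
  unfolding cauchy_density_deriv_def[abs_def] by measurable

lemma measurable_cauchy_density [measurable]: "cauchy_density t \<in> borel_measurable borel"
  unfolding cauchy_density_def[abs_def] by measurable

lemma measurable_poisson_deriv [measurable]: "poisson_deriv A t \<in> borel_measurable borel"
proof -
  have "poisson_deriv A t = (\<lambda>x. \<Prod>i\<in>UNIV.
      (if i \<in> A then cauchy_density_deriv (t $ i) else cauchy_density (t $ i)) (x $ i))"
    by (simp add: fun_eq_iff poisson_deriv_def if_distribR)
  also have "\<dots> \<in> borel_measurable borel"
  proof (intro borel_measurable_prod measurable_compose[OF borel_measurable_nth])
    show "(if i \<in> A then cauchy_density_deriv (t $ i) else cauchy_density (t $ i)) \<in> borel_measurable borel" for i
      by simp
  qed
  finally show ?thesis .
qed

lemma cauchy_density_le: "t > 0 \<Longrightarrow> cauchy_density t y \<le> 1 / (pi * t)"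
  using sum_squares_pos[of t y]
  by (simp add: cauchy_density_def divide_simps power2_eq_square)

lemma abs_cauchy_density_deriv_le:
  assumes "t > 0"
  shows "\<bar>cauchy_density_deriv t y\<bar> \<le> 1 / (pi * t\<^sup>2)"
proof -
  have "2 * t * \<bar>y\<bar> \<le> y\<^sup>2 + t\<^sup>2"
    using zero_le_power2[of "\<bar>y\<bar> - t"] by (simp add: power2_diff mult_ac)
  then have "2 * t * \<bar>y\<bar> / (pi * (y\<^sup>2 + t\<^sup>2)\<^sup>2) \<le> (y\<^sup>2 + t\<^sup>2) / (pi * (y\<^sup>2 + t\<^sup>2)\<^sup>2)"
    by (intro divide_right_mono) auto
  also have "\<dots> = 1 / (pi * (y\<^sup>2 + t\<^sup>2))"
    using sum_squares_pos[OF assms, of y] by (simp add: power2_eq_square)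
  also have "\<dots> \<le> 1 / (pi * t\<^sup>2)"
    using assms sum_squares_pos[OF assms, of y]
    by (intro divide_left_mono mult_left_mono mult_pos_pos) auto
  finally show ?thesis
    using assms by (simp add: cauchy_density_deriv_def abs_mult)
qed

text \<open>Each coordinate uses the sum of the bounds for the density and for its derivative, so
  the constant depends neither on A nor on x.\<close>

lemma abs_poisson_deriv_le:
  assumes "t \<in> pos_orthant"
  shows "\<bar>poisson_deriv A t x\<bar> \<le> (\<Prod>i\<in>UNIV. 1 / (pi * (t $ i)\<^sup>2) + 1 / (pi * t $ i))"
  unfolding poisson_deriv_def abs_prod
proof (intro prod_mono conjI)
  fix i
  have t: "t $ i > 0"
    using assms by (simp add: pos_orthant_def)
  have "0 \<le> 1 / (pi * (t $ i)\<^sup>2)" "0 \<le> 1 / (pi * t $ i)"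
    using t by simp_all
  then show "\<bar>if i \<in> A then cauchy_density_deriv (t $ i) (x $ i) else cauchy_density (t $ i) (x $ i)\<bar>
      \<le> 1 / (pi * (t $ i)\<^sup>2) + 1 / (pi * t $ i)"
    using abs_cauchy_density_deriv_le[OF t, of "x $ i"] cauchy_density_le[OF t, of "x $ i"]
      cauchy_density_nonneg[OF t, of "x $ i"]
    by (auto simp: abs_of_nonneg)
qed simp

lemma has_real_derivative_poisson_deriv:
  assumes t: "t \<in> pos_orthant" and j: "j \<notin> A"
  shows "((\<lambda>h. poisson_deriv A t (x + h *\<^sub>R axis j 1)) has_real_derivative
    poisson_deriv (insert j A) t (x + h *\<^sub>R axis j 1)) (at h)"
proof -
  let ?g = "\<lambda>i y. if i \<in> A then cauchy_density_deriv (t $ i) y else cauchy_density (t $ i) y"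
  let ?R = "\<Prod>i\<in>UNIV - {j}. ?g i (x $ i)"
  have split: "poisson_deriv A t (x + h *\<^sub>R axis j 1) = cauchy_density (t $ j) (x $ j + h) * ?R"
    "poisson_deriv (insert j A) t (x + h *\<^sub>R axis j 1) = cauchy_density_deriv (t $ j) (x $ j + h) * ?R" for h
  proof -
    have "(\<Prod>i\<in>UNIV. p i) = p j * (\<Prod>i\<in>UNIV - {j}. p i)" for p :: "_ \<Rightarrow> real"
      by (simp add: prod.remove)
    note remove = this
    show "poisson_deriv A t (x + h *\<^sub>R axis j 1) = cauchy_density (t $ j) (x $ j + h) * ?R"
      unfolding poisson_deriv_def remove using j
      by (intro arg_cong2[where f = "(*)"] prod.cong) (auto simp: axis_def)
    show "poisson_deriv (insert j A) t (x + h *\<^sub>R axis j 1) = cauchy_density_deriv (t $ j) (x $ j + h) * ?R"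
      unfolding poisson_deriv_def remove
      by (intro arg_cong2[where f = "(*)"] prod.cong) (auto simp: axis_def)
  qed
  have "((\<lambda>h. cauchy_density (t $ j) (x $ j + h)) has_real_derivative
      cauchy_density_deriv (t $ j) (x $ j + h)) (at h)"
    using has_real_derivative_cauchy_density[of "t $ j" "x $ j + h"] t
    by (simp add: DERIV_shift add.commute[of "x $ j"] pos_orthant_def)
  then show ?thesis
    unfolding split by (rule DERIV_cmult_right)
qed

lemma integrable_poisson_deriv_convol:
  fixes f :: "real ^ 'n::finite \<Rightarrow> complex"
  assumes t: "t \<in> pos_orthant" and f: "integrable lborel f"
  shows "integrable lborel (\<lambda>y. of_real (poisson_deriv A t (x - y)) * f y)"
proof (rule Bochner_Integration.integrable_bound)
  note [measurable] = borel_measurable_integrable[OF f]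
  let ?B = "\<Prod>i\<in>UNIV. 1 / (pi * (t $ i)\<^sup>2) + 1 / (pi * t $ i)"
  show "integrable lborel (\<lambda>y. ?B *\<^sub>R f y)"
    using f by simp
  show "AE y in lborel. cmod (of_real (poisson_deriv A t (x - y)) * f y) \<le> cmod (?B *\<^sub>R f y)"
    using abs_poisson_deriv_le[OF t, of A]
    by (intro AE_I2) (auto simp: norm_mult intro!: mult_right_mono order_trans[OF _ abs_ge_self])
  show "(\<lambda>y. of_real (poisson_deriv A t (x - y)) * f y) \<in> borel_measurable lborel"
    by measurable
qed

text \<open>The kernel bound is uniform in the point, so a constant multiple of |f| dominates the
  differentiated integrand for all h.\<close>

lemma partial_poisson_deriv_convol:
  fixes f :: "real ^ 'n::finite \<Rightarrow> complex"
  assumes t: "t \<in> pos_orthant" and f: "integrable lborel f" and j: "j \<notin> A"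
  shows "partial j (convol (\<lambda>y. of_real (poisson_deriv A t y)) f)
    = convol (\<lambda>y. of_real (poisson_deriv (insert j A) t y)) f"
proof
  fix x
  note [measurable] = borel_measurable_integrable[OF f]
  let ?B = "\<Prod>i\<in>UNIV. 1 / (pi * (t $ i)\<^sup>2) + 1 / (pi * t $ i)"
  let ?G = "\<lambda>A h y. of_real (poisson_deriv A t (x + h *\<^sub>R axis j 1 - y)) * f y"
  have "((\<lambda>h. \<integral>y. ?G A h y \<partial>lborel) has_vector_derivative (\<integral>y. ?G (insert j A) 0 y \<partial>lborel)) (at 0)"
  proof (rule has_vector_derivative_lebesgue_integral[where B = "\<lambda>y. ?B * cmod (f y)"])
    show "integrable lborel (?G A h)" for h
      by (rule integrable_poisson_deriv_convol[OF t f])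
    show "((\<lambda>h. ?G A h y) has_vector_derivative ?G (insert j A) h y) (at h)" for h y
    proof -
      have "((\<lambda>h. poisson_deriv A t (x - y + h *\<^sub>R axis j 1)) has_vector_derivative
          poisson_deriv (insert j A) t (x - y + h *\<^sub>R axis j 1)) (at h)"
        using has_real_derivative_poisson_deriv[OF t j]
        by (simp add: has_real_derivative_iff_has_vector_derivative)
      from has_vector_derivative_mult_left[OF bounded_linear.has_vector_derivative[OF bounded_linear_of_real this]]
      show ?thesis
        by (simp add: add_diff_eq diff_add_eq)
    qed
    show "cmod (?G (insert j A) h y) \<le> ?B * cmod (f y)" for h y
      using abs_poisson_deriv_le[OF t, of "insert j A"] by (simp add: norm_mult mult_right_mono)
    show "integrable lborel (\<lambda>y. ?B * cmod (f y))"
      using f by simp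
    show "?G (insert j A) 0 \<in> borel_measurable lborel"
      by measurable
  qed
  from vector_derivative_at[OF this]
  show "partial j (convol (\<lambda>y. of_real (poisson_deriv A t y)) f) x
    = convol (\<lambda>y. of_real (poisson_deriv (insert j A) t y)) f x"
    by (simp add: partial_def convol_def)
qed

text \<open>\<open>partials\<close> applies the head of the list last, so each induction step adds
  one coordinate to the set; distinctness guarantees that it is new.\<close>

lemma partials_poisson_integral:
  fixes f :: "real ^ 'n::finite \<Rightarrow> complex"
  assumes t: "t \<in> pos_orthant" and f: "integrable lborel f" and "distinct js"
  shows "partials js (\<lambda>x. poisson_integral f x t) = convol (\<lambda>y. of_real (poisson_deriv (set js) t y)) f"
  using \<open>distinct js\<close>
proof (induction js)
  case Nil
  show ?case
    by (simp add: partials_def poisson_integral_def poisson_deriv_empty)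
next
  case (Cons j js)
  then show ?case
    using partial_poisson_deriv_convol[OF t f, of j "set js"] by (simp add: partials_def)
qed

subsection \<open>Superposition in several variables\<close>

definition weight_kernel :: "real ^ 'n::finite \<Rightarrow> real ^ 'n \<Rightarrow> real ^ 'n \<Rightarrow> real" where
  "weight_kernel \<alpha> t s = (\<Prod>i\<in>UNIV. weight (\<alpha> $ i) (t $ i) (s $ i))"

lemma poisson_kernel_eq: "poisson_kernel t x = (\<Prod>i\<in>UNIV. cauchy_density (t $ i) (x $ i))"
  by (simp add: poisson_kernel_def cauchy_density_def)

lemma poisson_kernel_nonneg: "t \<in> pos_orthant \<Longrightarrow> 0 \<le> poisson_kernel t x"
  by (simp add: poisson_kernel_eq pos_orthant_def prod_nonneg cauchy_density_nonneg)

lemma nn_integral_poisson_kernel: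
  "t \<in> pos_orthant \<Longrightarrow> (\<integral>\<^sup>+x. ennreal (poisson_kernel t x) \<partial>lborel) = 1"
  unfolding poisson_kernel_eq
  by (subst nn_integral_lborel_prod_vec)
    (auto simp: pos_orthant_def cauchy_density_nonneg nn_integral_cauchy_density)

lemma poisson_kernel_sym:
  assumes "s \<in> pos_orthant" "t \<in> pos_orthant"
  shows "poisson_kernel t s / (\<Prod>i\<in>UNIV. t $ i) = poisson_kernel s t / (\<Prod>i\<in>UNIV. s $ i)"
  using assms by (simp add: poisson_kernel_eq pos_orthant_def cauchy_density_sym flip: prod_dividef)

text \<open>In product form the indicator can be absorbed into the one-dimensional
  integrands.\<close>

lemma indicator_pos_orthant: "indicator pos_orthant s = (\<Prod>i\<in>UNIV. indicator {0<..} (s $ i) :: real)"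
  by (auto simp: indicator_def pos_orthant_def prod_zero_iff not_less)

lemma pos_orthant_borel [measurable]: "(pos_orthant :: (real ^ 'n::finite) set) \<in> sets borel"
proof -
  have "(pos_orthant :: (real ^ 'n) set) = (\<Inter>i. (\<lambda>t. t $ i) -` {0<..})"
    by (auto simp: pos_orthant_def)
  also have "\<dots> \<in> sets borel"
    by (intro borel_open open_INT ballI open_vimage continuous_intros) auto
  finally show ?thesis .
qed

lemma abs_weight_kernel_le:
  assumes "\<And>i. 0 < \<alpha> $ i" "t \<in> pos_orthant" "s \<in> pos_orthant"
  shows "\<bar>weight_kernel \<alpha> t s\<bar> \<le> (\<Prod>i\<in>UNIV. \<alpha> $ i + 1) * poisson_kernel t s"
proof -
  have "\<bar>weight_kernel \<alpha> t s\<bar> \<le> (\<Prod>i\<in>UNIV. (\<alpha> $ i + 1) * cauchy_density (t $ i) (s $ i))"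
    unfolding weight_kernel_def abs_prod
    using assms by (intro prod_mono conjI abs_weight_le) (auto simp: pos_orthant_def)
  then show ?thesis
    by (simp add: poisson_kernel_eq prod.distrib)
qed

lemma measurable_nth_vec [measurable]: "(\<lambda>x :: real ^ 'n::finite. x $ i) \<in> borel_measurable borel"
  by (intro borel_measurable_continuous_onI continuous_intros)

text \<open>Both arguments may vary, because the double integral over y and s and the measurability
  of \<open>S_op\<close> in its dilation parameter rest on joint measurability.\<close>

lemma measurable_Phi [measurable (raw)]:
  fixes s y :: "'a \<Rightarrow> real ^ 'n::finite"
  assumes [measurable]: "s \<in> borel_measurable M" "y \<in> borel_measurable M"
  shows "(\<lambda>x. Phi \<alpha> (s x) (y x)) \<in> borel_measurable M"
  unfolding Phi_def phi_dil_def phi_def by measurable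

lemma measurable_weight_kernel [measurable]:
  assumes "t \<in> pos_orthant"
  shows "weight_kernel \<alpha> t \<in> borel_measurable borel"
  unfolding weight_kernel_def
  by (intro borel_measurable_prod measurable_compose[OF measurable_nth_vec] measurable_weight)
    (use assms in \<open>simp add: pos_orthant_def\<close>)

lemma measurable_S_op [measurable]:
  fixes f :: "real ^ 'n::finite \<Rightarrow> complex"
  assumes [measurable]: "f \<in> borel_measurable borel"
  shows "(\<lambda>s. S_op \<alpha> s f x) \<in> borel_measurable borel"
  unfolding S_op_def convol_def by measurable

text \<open>One double integral over y and s is evaluated in both orders: integrating s first gives
  the differentiated Poisson kernel coordinate by coordinate, integrating y first gives
  \<open>S_op\<close>. Fubini's theorem applies because the inner integral of absolute values is at
  most B |f(x-y)|.\<close>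

lemma
  fixes f :: "real ^ 'n::finite \<Rightarrow> complex"
  assumes \<alpha>: "\<And>i. 0 < \<alpha> $ i" and t: "t \<in> pos_orthant" and f: "integrable lborel f"
  shows integrable_weight_kernel_S_op:
      "integrable lborel (\<lambda>s. of_real (indicator pos_orthant s * weight_kernel \<alpha> t s) * S_op \<alpha> s f x)"
    and integral_weight_kernel_S_op:
      "(\<integral>s. of_real (indicator pos_orthant s * weight_kernel \<alpha> t s) * S_op \<alpha> s f x \<partial>lborel)
        = of_real (\<Prod>i\<in>UNIV. t $ i) * convol (\<lambda>y. of_real (poisson_deriv UNIV t y)) f x"
proof -
  note [measurable] = borel_measurable_integrable[OF f] measurable_weight_kernel[OF t]
  have t_pos: "0 < t $ i" for i
    using t by (simp add: pos_orthant_def)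
  define h where "h i y s = indicator {0<..} s * (phi_dil (\<alpha> $ i) s y * weight (\<alpha> $ i) (t $ i) s)" for i y s
  define B where "B = (\<Prod>i\<in>UNIV. (\<alpha> $ i + 1) * 2 powr (\<alpha> $ i + 1) / (pi * t $ i))"
  let ?H = "\<lambda>y s. f (x - y) * of_real (\<Prod>i\<in>UNIV. h i (y $ i) (s $ i))"
  have h: "integrable lborel (h i y)" "integral\<^sup>L lborel (h i y) = t $ i * cauchy_density_deriv (t $ i) y"
      "(\<integral>s. \<bar>h i y s\<bar> \<partial>lborel) \<le> (\<alpha> $ i + 1) * 2 powr (\<alpha> $ i + 1) / (pi * t $ i)" for i y
    unfolding h_def
    by (rule integrable_phi_dil_weight integral_phi_dil_weight integral_abs_phi_dil_weight_le; fact \<alpha> t_pos)+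
  \<comment> \<open>The left form factors over coordinates for the integration in s; the right form
    isolates \<open>Phi\<close> for the integration in y.\<close>
  have prod_h: "(\<Prod>i\<in>UNIV. h i (y $ i) (s $ i)) = indicator pos_orthant s * weight_kernel \<alpha> t s * Phi \<alpha> s y" for y s
    by (simp add: h_def prod.distrib indicator_pos_orthant weight_kernel_def Phi_def mult_ac)
  have meas: "case_prod ?H \<in> borel_measurable (lborel \<Otimes>\<^sub>M lborel)"
    unfolding prod_h by measurable
  have integrable_H: "integrable lborel (?H y)" for y
    using integrable_lborel_prod_vec[of "\<lambda>i. h i (y $ i)"] h(1) by (intro integrable_mult_right integrable_of_real) auto
  have f_refl: "integrable lborel (\<lambda>y. f (x - y))"
    using f by (rule integrable_lborel_reflect)
  have int: "integrable (lborel \<Otimes>\<^sub>M lborel) (case_prod ?H)"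
  proof (rule lborel_pair.Fubini_integrable[OF meas])
    have norm_H: "(\<integral>s. cmod (?H y s) \<partial>lborel) = cmod (f (x - y)) * (\<Prod>i\<in>UNIV. \<integral>s. \<bar>h i (y $ i) s\<bar> \<partial>lborel)" for y
      using integral_lborel_prod_vec[of "\<lambda>i s. \<bar>h i (y $ i) s\<bar>"] h(1)
      by (simp add: norm_mult abs_prod flip: prod_norm)
    have B: "(\<Prod>i\<in>UNIV. \<integral>s. \<bar>h i (y $ i) s\<bar> \<partial>lborel) \<le> B" "0 \<le> (\<Prod>i\<in>UNIV. \<integral>s. \<bar>h i (y $ i) s\<bar> \<partial>lborel)" for y :: "real ^ 'n"
      unfolding B_def by (intro prod_mono prod_nonneg conjI h; simp)+
    show "integrable lborel (\<lambda>y. \<integral>s. cmod (case_prod ?H (y, s)) \<partial>lborel)"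
    proof (rule Bochner_Integration.integrable_bound)
      show "integrable lborel (\<lambda>y. B * cmod (f (x - y)))"
        using f_refl by simp
      show "(\<lambda>y. \<integral>s. cmod (case_prod ?H (y, s)) \<partial>lborel) \<in> borel_measurable lborel"
        using meas by measurable
      show "AE y in lborel. norm (\<integral>s. cmod (case_prod ?H (y, s)) \<partial>lborel) \<le> norm (B * cmod (f (x - y)))"
      proof (rule AE_I2)
        fix y
        show "norm (\<integral>s. cmod (case_prod ?H (y, s)) \<partial>lborel) \<le> norm (B * cmod (f (x - y)))"
          using B[of y] unfolding prod.case norm_H by (simp add: abs_mult mult.commute[of "cmod _"] mult_right_mono)
      qed
    qed
    show "AE y in lborel. integrable lborel (\<lambda>s. case_prod ?H (y, s))"
      using integrable_H by simp
  qed
  have inner: "(\<integral>y. ?H y s \<partial>lborel) = of_real (indicator pos_orthant s * weight_kernel \<alpha> t s) * S_op \<alpha> s f x" for s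
  proof -
    have "(\<integral>y. ?H y s \<partial>lborel) = (\<integral>y. of_real (indicator pos_orthant s * weight_kernel \<alpha> t s) * (f (x - y) * of_real (Phi \<alpha> s y)) \<partial>lborel)"
      unfolding prod_h by (intro Bochner_Integration.integral_cong) (auto simp: mult_ac)
    then show ?thesis
      by (simp add: S_op_def convol_def)
  qed
  show "integrable lborel (\<lambda>s. of_real (indicator pos_orthant s * weight_kernel \<alpha> t s) * S_op \<alpha> s f x)"
    using lborel_pair.integrable_snd[OF int] by (simp only: inner)
  have "(\<integral>s. of_real (indicator pos_orthant s * weight_kernel \<alpha> t s) * S_op \<alpha> s f x \<partial>lborel)
      = (\<integral>y. (\<integral>s. ?H y s \<partial>lborel) \<partial>lborel)"
    using lborel_pair.Fubini_integral[OF int] by (simp only: inner)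
  also have "\<dots> = (\<integral>y. of_real (\<Prod>i\<in>UNIV. t $ i) * (of_real (poisson_deriv UNIV t y) * f (x - y)) \<partial>lborel)"
  proof (intro Bochner_Integration.integral_cong refl)
    fix y
    have "(\<integral>s. ?H y s \<partial>lborel) = f (x - y) * of_real (\<integral>s. (\<Prod>i\<in>UNIV. h i (y $ i) ((s :: real ^ 'n) $ i)) \<partial>lborel)"
      by (simp only: integral_mult_right_zero integral_complex_of_real)
    also have "(\<integral>s. (\<Prod>i\<in>UNIV. h i (y $ i) ((s :: real ^ 'n) $ i)) \<partial>lborel)
        = (\<Prod>i\<in>UNIV. t $ i) * poisson_deriv UNIV t y"
      using integral_lborel_prod_vec[of "\<lambda>i. h i (y $ i)", OF h(1)]
      by (simp add: h(2) poisson_deriv_def prod.distrib)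
    finally show "(\<integral>s. ?H y s \<partial>lborel) = of_real (\<Prod>i\<in>UNIV. t $ i) * (of_real (poisson_deriv UNIV t y) * f (x - y))"
      by simp
  qed
  also have "\<dots> = of_real (\<Prod>i\<in>UNIV. t $ i) * (\<integral>y. of_real (poisson_deriv UNIV t y) * f (x - y) \<partial>lborel)"
    by (rule integral_mult_right_zero)
  \<comment> \<open>In \<open>S_op\<close> the kernel is the second argument of
    \<open>convol\<close>, in the Poisson integral the first; the reflection y -> x - y reconciles
    the two.\<close>
  also have "(\<integral>y. of_real (poisson_deriv UNIV t y) * f (x - y) \<partial>lborel)
      = convol (\<lambda>y. of_real (poisson_deriv UNIV t y)) f x"
    unfolding convol_def
    using integral_lborel_reflect[of "\<lambda>y. of_real (poisson_deriv UNIV t (x - y)) * f y" x] by simp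
  finally show "(\<integral>s. of_real (indicator pos_orthant s * weight_kernel \<alpha> t s) * S_op \<alpha> s f x \<partial>lborel)
        = of_real (\<Prod>i\<in>UNIV. t $ i) * convol (\<lambda>y. of_real (poisson_deriv UNIV t y)) f x" .
qed

subsection \<open>The Schur estimate\<close>

text \<open>Absolute values are taken inside the superposition formula and the weight is replaced by
  its Poisson majorant. In \<open>ennreal\<close> the right-hand side makes sense without a
  finiteness argument.\<close>

lemma cmod_partials_poisson_integral_le:
  fixes f :: "real ^ 'n::{finite, linorder} \<Rightarrow> complex"
  assumes \<alpha>: "\<And>i. 0 < \<alpha> $ i" and t: "t \<in> pos_orthant" and f: "integrable lborel f"
  shows "ennreal (cmod (partials (sorted_list_of_set UNIV) (\<lambda>x. poisson_integral f x t) x) * (\<Prod>i\<in>UNIV. t $ i))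
    \<le> ennreal (\<Prod>i\<in>UNIV. \<alpha> $ i + 1)
      * (\<integral>\<^sup>+s\<in>pos_orthant. ennreal (poisson_kernel t s * cmod (S_op \<alpha> s f x)) \<partial>lborel)"
proof -
  note [measurable] = borel_measurable_integrable[OF f]
  let ?I = "\<lambda>s. of_real (indicator pos_orthant s * weight_kernel \<alpha> t s) * S_op \<alpha> s f x"
  let ?K = "\<Prod>i\<in>UNIV. \<alpha> $ i + 1"
  have K: "0 \<le> ?K"
    by (intro prod_nonneg) (simp add: add_nonneg_nonneg less_imp_le \<alpha>)
  have prod_t: "0 \<le> (\<Prod>i\<in>UNIV. t $ i)"
    using t by (intro prod_nonneg) (simp add: pos_orthant_def less_imp_le)
  have "of_real (\<Prod>i\<in>UNIV. t $ i) * partials (sorted_list_of_set UNIV) (\<lambda>x. poisson_integral f x t) x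
      = (\<integral>s. ?I s \<partial>lborel)"
    using integral_weight_kernel_S_op[OF \<alpha> t f] partials_poisson_integral[OF t f, of "sorted_list_of_set UNIV"]
    by simp
  then have "cmod (partials (sorted_list_of_set UNIV) (\<lambda>x. poisson_integral f x t) x) * (\<Prod>i\<in>UNIV. t $ i)
      = cmod (\<integral>s. ?I s \<partial>lborel)"
    using prod_t by (metis mult.commute norm_mult norm_of_real abs_of_nonneg)
  also have "ennreal \<dots> \<le> (\<integral>\<^sup>+s. ennreal (cmod (?I s)) \<partial>lborel)"
    using integrable_weight_kernel_S_op[OF \<alpha> t f] by (rule integral_norm_bound_ennreal)
  also have "\<dots> \<le> (\<integral>\<^sup>+s. ennreal ?K * (ennreal (poisson_kernel t s * cmod (S_op \<alpha> s f x)) * indicator pos_orthant s) \<partial>lborel)"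
  proof (rule nn_integral_mono)
    fix s
    show "ennreal (cmod (?I s))
        \<le> ennreal ?K * (ennreal (poisson_kernel t s * cmod (S_op \<alpha> s f x)) * indicator pos_orthant s)"
    proof (cases "s \<in> pos_orthant")
      case True
      then have "cmod (?I s) \<le> ?K * poisson_kernel t s * cmod (S_op \<alpha> s f x)"
        using abs_weight_kernel_le[OF \<alpha> t] by (simp add: norm_mult mult_right_mono)
      then show ?thesis
        using True K by (simp add: ennreal_mult' ennreal_leI mult.assoc flip: ennreal_mult')
    qed simp
  qed
  also have "\<dots> = ennreal ?K * (\<integral>\<^sup>+s\<in>pos_orthant. ennreal (poisson_kernel t s * cmod (S_op \<alpha> s f x)) \<partial>lborel)"
    by (rule nn_integral_cmult) (simp add: poisson_kernel_eq)
  finally show ?thesis .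
qed

text \<open>Split the kernel into two square roots and apply Cauchy-Schwarz; one factor becomes the
  total mass of the kernel.\<close>

lemma nn_integral_poisson_kernel_power2_le:
  fixes F :: "real ^ 'n::finite \<Rightarrow> real"
  assumes [measurable]: "F \<in> borel_measurable borel" and t: "t \<in> pos_orthant" and F: "\<And>s. 0 \<le> F s"
  shows "(\<integral>\<^sup>+s\<in>pos_orthant. ennreal (poisson_kernel t s * F s) \<partial>lborel)\<^sup>2
    \<le> (\<integral>\<^sup>+s\<in>pos_orthant. ennreal (poisson_kernel t s * (F s)\<^sup>2) \<partial>lborel)"
proof -
  have [measurable]: "poisson_kernel t \<in> borel_measurable borel"
    by (simp flip: poisson_deriv_empty)
  \<comment> \<open>The orthant indicator is attached to \<open>?q\<close> only, so the integral of
    the square of \<open>?p\<close> is exactly 1.\<close>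
  let ?p = "\<lambda>s. ennreal (sqrt (poisson_kernel t s))"
  let ?q = "\<lambda>s. ennreal (sqrt (poisson_kernel t s) * F s) * indicator pos_orthant s"
  note nn = poisson_kernel_nonneg[OF t]
  have "(\<integral>\<^sup>+s\<in>pos_orthant. ennreal (poisson_kernel t s * F s) \<partial>lborel) = (\<integral>\<^sup>+s. ?p s * ?q s \<partial>lborel)"
    using nn F by (intro nn_integral_cong) (simp add: mult.assoc[symmetric] flip: ennreal_mult')
  moreover have "(\<integral>\<^sup>+s. ?p s * ?q s \<partial>lborel)\<^sup>2 \<le> (\<integral>\<^sup>+s. ?p s ^ 2 \<partial>lborel) * (\<integral>\<^sup>+s. ?q s ^ 2 \<partial>lborel)"
    by (rule Cauchy_Schwarz_nn_integral) measurable
  moreover have "?p s ^ 2 = ennreal (poisson_kernel t s)" for s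
    using nn by (simp add: ennreal_power)
  moreover have "?q s ^ 2 = ennreal (poisson_kernel t s * (F s)\<^sup>2) * indicator pos_orthant s" for s
    using nn F by (cases "s \<in> pos_orthant") (simp_all add: ennreal_power power_mult_distrib)
  ultimately show ?thesis
    using nn_integral_poisson_kernel[OF t] by simp
qed

text \<open>
  By \<open>poisson_kernel_sym\<close> the kernel is also integrable in \<open>t\<close> with respect to $\prod_i dt_i/t_i$.
\<close>

lemma nn_integral_poisson_kernel_schur_le:
  fixes F :: "real ^ 'n::finite \<Rightarrow> real"
  assumes [measurable]: "F \<in> borel_measurable borel" and F: "\<And>s. 0 \<le> F s"
  shows "(\<integral>\<^sup>+t\<in>pos_orthant. ennreal (1 / (\<Prod>i\<in>UNIV. t $ i))
        * (\<integral>\<^sup>+s\<in>pos_orthant. ennreal (poisson_kernel t s * (F s)\<^sup>2) \<partial>lborel) \<partial>lborel)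
    \<le> (\<integral>\<^sup>+s\<in>pos_orthant. ennreal ((F s)\<^sup>2 / (\<Prod>i\<in>UNIV. s $ i)) \<partial>lborel)"
proof -
  let ?H = "\<lambda>t s. ennreal (1 / (\<Prod>i\<in>UNIV. t $ i)) * indicator pos_orthant t
      * (ennreal (poisson_kernel t s * (F s)\<^sup>2) * indicator pos_orthant s)"
  have [measurable]: "(\<lambda>(t, s). poisson_kernel t s) \<in> borel_measurable (borel \<Otimes>\<^sub>M borel)"
    unfolding poisson_kernel_def by measurable
  have meas: "case_prod ?H \<in> borel_measurable (lborel \<Otimes>\<^sub>M lborel)"
    by measurable
  have "(\<integral>\<^sup>+t\<in>pos_orthant. ennreal (1 / (\<Prod>i\<in>UNIV. t $ i))
        * (\<integral>\<^sup>+s\<in>pos_orthant. ennreal (poisson_kernel t s * (F s)\<^sup>2) \<partial>lborel) \<partial>lborel)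
      = (\<integral>\<^sup>+t. (\<integral>\<^sup>+s. ?H t s \<partial>lborel) \<partial>lborel)"
    by (intro nn_integral_cong, subst nn_integral_cmult) (auto simp: mult_ac poisson_kernel_def)
  also have "\<dots> = (\<integral>\<^sup>+s. (\<integral>\<^sup>+t. ?H t s \<partial>lborel) \<partial>lborel)"
    using lborel_pair.Fubini'[OF meas] by simp
  also have "\<dots> \<le> (\<integral>\<^sup>+s\<in>pos_orthant. ennreal ((F s)\<^sup>2 / (\<Prod>i\<in>UNIV. s $ i)) \<partial>lborel)"
  proof (rule nn_integral_mono)
    fix s :: "real ^ 'n"
    show "(\<integral>\<^sup>+t. ?H t s \<partial>lborel) \<le> ennreal ((F s)\<^sup>2 / (\<Prod>i\<in>UNIV. s $ i)) * indicator pos_orthant s"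
    proof (cases "s \<in> pos_orthant")
      case True
      let ?c = "(F s)\<^sup>2 / (\<Prod>i\<in>UNIV. s $ i)"
      have c: "0 \<le> ?c"
        using True by (intro divide_nonneg_nonneg prod_nonneg) (auto simp: pos_orthant_def less_imp_le)
      \<comment> \<open>After the exchange of s and t in the kernel, dropping the orthant condition
        on t can only enlarge the integral, and it leaves the full mass 1 of a probability density
        in t.\<close>
      have "?H t s \<le> ennreal ?c * ennreal (poisson_kernel s t)" for t
      proof (cases "t \<in> pos_orthant")
        case t: True
        have "0 \<le> 1 / (\<Prod>i\<in>UNIV. t $ i)"
          using t by (intro divide_nonneg_nonneg prod_nonneg) (auto simp: pos_orthant_def less_imp_le)
        then have "?H t s = ennreal ((poisson_kernel t s / (\<Prod>i\<in>UNIV. t $ i)) * (F s)\<^sup>2)"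
          using t True by (simp flip: ennreal_mult')
        also have "\<dots> = ennreal (?c * poisson_kernel s t)"
          unfolding poisson_kernel_sym[OF True t] by (simp add: mult.commute)
        also have "\<dots> = ennreal ?c * ennreal (poisson_kernel s t)"
          using c by (rule ennreal_mult')
        finally show ?thesis
          by simp
      qed simp
      then have "(\<integral>\<^sup>+t. ?H t s \<partial>lborel) \<le> (\<integral>\<^sup>+t. ennreal ?c * ennreal (poisson_kernel s t) \<partial>lborel)"
        by (rule nn_integral_mono)
      also have "\<dots> = ennreal ?c"
        using nn_integral_poisson_kernel[OF True]
        by (subst nn_integral_cmult) (auto simp: poisson_kernel_def)
      finally show ?thesis
        using True by simp
    qed simp
  qed
  finally show ?thesis .
qed

text \<open>If b is infinite, so is the right-hand side. Otherwise a is finite as well and the claim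
  is monotonicity of the real square root.\<close>

lemma ennreal_sqrt_le:
  assumes "a \<le> ennreal (K\<^sup>2) * b" and "K > 0"
  shows "ennreal_sqrt a \<le> ennreal K * ennreal_sqrt b"
proof (cases b rule: ennreal_cases)
  case top
  then show ?thesis
    using \<open>K > 0\<close> by (simp add: ennreal_sqrt_def ennreal_mult_top)
next
  case (real r)
  then have "a \<le> ennreal (K\<^sup>2 * r)"
    using assms by (simp add: ennreal_mult')
  moreover from this obtain q where "a = ennreal q" "0 \<le> q"
    by (cases a rule: ennreal_cases) (auto simp: top_unique)
  ultimately have "sqrt q \<le> sqrt (K\<^sup>2 * r)"
    using real by (auto simp: ennreal_le_iff)
  also have "\<dots> = K * sqrt r"
    using \<open>K > 0\<close> by (simp add: real_sqrt_mult)
  finally show ?thesis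
    using \<open>a = ennreal q\<close> \<open>0 \<le> q\<close> real \<open>K > 0\<close>
    by (simp add: ennreal_sqrt_def ennreal_leI flip: ennreal_mult')
qed

theorem theorem5:
  fixes \<alpha> :: "real ^ 'n::{finite,linorder}"
  assumes "\<And>i. 0 < \<alpha> $ i"
  shows "\<exists>C::real. 0 \<le> C \<and>
    (\<forall>f\<in>schwartz. \<forall>x. g0 f x \<le> ennreal C * marcinkiewicz \<alpha> f x)"
proof (intro exI conjI ballI allI)
  let ?K = "\<Prod>i\<in>UNIV. \<alpha> $ i + 1"
  have K: "0 < ?K"
    by (intro prod_pos) (simp add: add_pos_pos assms)
  then show "0 \<le> ?K"
    by simp
  fix f :: "(real, 'n) vec \<Rightarrow> complex" and x
  assume "f \<in> schwartz"
  then have f: "integrable lborel f"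
    by (rule integrable_schwartz)
  note [measurable] = borel_measurable_integrable[OF f]
  define F where "F s = cmod (S_op \<alpha> s f x)" for s
  have F[measurable]: "F \<in> borel_measurable borel"
    unfolding F_def by measurable
  have F_nonneg: "0 \<le> F s" for s
    by (simp add: F_def)
  let ?d = "\<lambda>t. cmod (partials (sorted_list_of_set UNIV) (\<lambda>x. poisson_integral f x t) x)"
  let ?J = "\<lambda>t. \<integral>\<^sup>+s\<in>pos_orthant. ennreal (poisson_kernel t s * (F s)\<^sup>2) \<partial>lborel"
  have pointwise: "ennreal ((?d t)\<^sup>2 * (\<Prod>i\<in>UNIV. t $ i))
      \<le> ennreal (?K\<^sup>2) * (ennreal (1 / (\<Prod>i\<in>UNIV. t $ i)) * ?J t)" if t: "t \<in> pos_orthant" for t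
  proof -
    let ?p = "\<Prod>i\<in>UNIV. t $ i"
    have p: "0 < ?p"
      using t by (intro prod_pos) (simp add: pos_orthant_def)
    \<comment> \<open>This passes from the weight in \<open>g0\<close> to the measure with density
      1/\<open>?p\<close>, with \<open>?d t * ?p\<close> as the quantity controlled by the
      superposition.\<close>
    have "(?d t)\<^sup>2 * ?p = 1 / ?p * (?d t * ?p)\<^sup>2"
      using p by (simp add: power2_eq_square)
    then have "ennreal ((?d t)\<^sup>2 * ?p) = ennreal (1 / ?p) * (ennreal (?d t * ?p))\<^sup>2"
      using p by (simp add: ennreal_power flip: ennreal_mult')
    also have "\<dots> \<le> ennreal (1 / ?p)
        * (ennreal ?K * (\<integral>\<^sup>+s\<in>pos_orthant. ennreal (poisson_kernel t s * F s) \<partial>lborel))\<^sup>2"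
      using cmod_partials_poisson_integral_le[OF assms t f, of x]
      by (intro mult_left_mono power_mono) (simp_all add: F_def)
    also have "\<dots> \<le> ennreal (1 / ?p) * ((ennreal ?K)\<^sup>2 * ?J t)"
      unfolding power_mult_distrib
      by (intro mult_left_mono nn_integral_poisson_kernel_power2_le[OF F t F_nonneg]) simp_all
    finally show ?thesis
      using K by (simp add: ennreal_power mult_ac)
  qed
  have "(\<integral>\<^sup>+t\<in>pos_orthant. ennreal ((?d t)\<^sup>2 * (\<Prod>i\<in>UNIV. t $ i)) \<partial>lborel)
      \<le> (\<integral>\<^sup>+t. ennreal (?K\<^sup>2) * (ennreal (1 / (\<Prod>i\<in>UNIV. t $ i)) * ?J t * indicator pos_orthant t) \<partial>lborel)"
    using pointwise by (intro nn_integral_mono) (simp add: indicator_def)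
  also have "\<dots> = ennreal (?K\<^sup>2) * (\<integral>\<^sup>+t\<in>pos_orthant. ennreal (1 / (\<Prod>i\<in>UNIV. t $ i)) * ?J t \<partial>lborel)"
    by (intro nn_integral_cmult) (simp add: poisson_kernel_def)
  also have "\<dots> \<le> ennreal (?K\<^sup>2) * (\<integral>\<^sup>+s\<in>pos_orthant. ennreal ((F s)\<^sup>2 / (\<Prod>i\<in>UNIV. s $ i)) \<partial>lborel)"
    by (intro mult_left_mono nn_integral_poisson_kernel_schur_le F F_nonneg) simp
  finally show "g0 f x \<le> ennreal ?K * marcinkiewicz \<alpha> f x"
    unfolding g0_def marcinkiewicz_def F_def by (intro ennreal_sqrt_le K)
qed

end
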